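(* For every $n\in\mathbb N$ there are enumeration degrees $p_n,q_n$ such that: (i) $p_n$ is the product of $n+1$ semirecursive degrees, but not of $n$ semirecursive degrees and a Turing degree; (ii) $q_n$ is the product of $n$ semirecursive degrees and a Turing degree, but it is neither the product of $n-1$ semirecursive degrees and a Turing degree, nor the product of $n+1$ semirecursive degrees.
   Context: A set $A\subseteq\mathbb N$ is semirecursive if there is a computable $f:\mathbb N\times\mathbb N\to\mathbb N$ such that for all $n,m$: $f(n,m)\in\{n,m\}$, and if $n\in A$ or $m\in A$ then $f(n,m)\in A$. An enumeration degree is semirecursive if it is the enumeration degree of some semirecursive set. Turing degrees are regarded as enumeration degrees via the standard embedding (degree of $A$ $\mapsto$ enumeration degree of $A\oplus(\mathbb N\setminus A)$). The product of enumeration degrees is the degree of the tuple of representatives, i.e. their join in the enumeration degrees. *)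

theory Defs
  imports Main "HOL-Library.Nat_Bijection"
begin

section \<open>Computable functions\<close>

text \<open>
  Programs for the partial recursive functions of Kleene. A program is not tied to an arity: it is
  run on an argument list, and its restriction to lists of length \<open>k\<close> is a partial recursive
  \<open>k\<close>-ary function.
\<close>

datatype recf =
    Zero
  | Succ
  | Proj nat
  | Comp recf "recf list"
  | PrimRec recf recf
  | Minim recf

inductive computes :: "recf \<Rightarrow> nat list \<Rightarrow> nat \<Rightarrow> bool" where
  Zero: "computes Zero xs 0"
| Succ: "computes Succ [x] (Suc x)"
| Proj: "i < length xs \<Longrightarrow> computes (Proj i) xs (xs ! i)"
| Comp: "list_all2 (\<lambda>g y. computes g xs y) gs ys \<Longrightarrow> computes f ys z \<Longrightarrow>
    computes (Comp f gs) xs z"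
| PrimRec_0: "computes f xs y \<Longrightarrow> computes (PrimRec f g) (0 # xs) y"
| PrimRec_Suc: "computes (PrimRec f g) (n # xs) y \<Longrightarrow> computes g (n # y # xs) z \<Longrightarrow>
    computes (PrimRec f g) (Suc n # xs) z"
| Minim: "computes f (y # xs) 0 \<Longrightarrow> (\<forall>z<y. \<exists>v. computes f (z # xs) (Suc v)) \<Longrightarrow>
    computes (Minim f) xs y"

inductive_cases computes_ZeroE: "computes Zero xs y"
inductive_cases computes_SuccE: "computes Succ xs y"
inductive_cases computes_ProjE: "computes (Proj i) xs y"
inductive_cases computes_CompE: "computes (Comp f gs) xs y"
inductive_cases computes_PrimRec_0E: "computes (PrimRec f g) (0 # xs) y"
inductive_cases computes_PrimRec_SucE: "computes (PrimRec f g) (Suc n # xs) y"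
inductive_cases computes_MinimE: "computes (Minim f) xs y"

lemma computes_deterministic:
  assumes "computes f xs y" "computes f xs y'"
  shows "y' = y"
  using assms
proof (induction arbitrary: y' rule: computes.induct)
  case (Zero xs)
  then show ?case by (rule computes_ZeroE)
next
  case (Succ x)
  then show ?case by (rule computes_SuccE) simp
next
  case (Proj i xs)
  from Proj.prems show ?case by (rule computes_ProjE) simp
next
  case (Comp xs gs ys f z)
  from Comp.prems obtain ys' where
    ys': "list_all2 (\<lambda>g y. computes g xs y) gs ys'" "computes f ys' y'"
    by (rule computes_CompE)
  have "ys' = ys"
  proof (rule nth_equalityI)
    show len: "length ys' = length ys"
      using Comp.IH(1) ys'(1) by (simp add: list_all2_conv_all_nth)
    fix i assume "i < length ys'"
    with len Comp.IH(1) ys'(1) show "ys' ! i = ys ! i"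
      by (simp add: list_all2_conv_all_nth)
  qed
  with ys'(2) Comp.IH(2) show ?case by blast
next
  case (PrimRec_0 f xs y g)
  from PrimRec_0.prems PrimRec_0.IH show ?case by (blast elim: computes_PrimRec_0E)
next
  case (PrimRec_Suc f g n xs y z)
  from PrimRec_Suc.prems obtain w where
    "computes (PrimRec f g) (n # xs) w" "computes g (n # w # xs) y'"
    by (rule computes_PrimRec_SucE)
  with PrimRec_Suc.IH show ?case by blast
next
  case (Minim f y xs)
  from Minim.prems obtain y': "computes f (y' # xs) 0"
    "\<forall>z<y'. \<exists>v. computes f (z # xs) (Suc v)"
    by (rule computes_MinimE)
  have "\<not> y < y'" using y'(2) Minim.IH(1) by blast
  moreover have "\<not> y' < y" using y'(1) Minim.IH(2) by blast
  ultimately show ?case by simp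
qed

definition computable1 :: "(nat \<Rightarrow> nat) \<Rightarrow> bool" where
  "computable1 f \<longleftrightarrow> (\<exists>p. \<forall>x. computes p [x] (f x))"

definition computable2 :: "(nat \<Rightarrow> nat \<Rightarrow> nat) \<Rightarrow> bool" where
  "computable2 f \<longleftrightarrow> (\<exists>p. \<forall>x y. computes p [x, y] (f x y))"

definition comp_enumerable :: "nat set \<Rightarrow> bool" where
  "comp_enumerable W \<longleftrightarrow> W = {} \<or> (\<exists>f. computable1 f \<and> W = range f)"


section \<open>Enumeration degrees\<close>

text \<open>
  The c.e. set \<open>W\<close> serves as an enumeration operator: the number coding \<open>(x, D)\<close> is the axiom
  ``enumerate \<open>x\<close> once all elements of the finite set \<open>D\<close> have been seen''. Pairs are coded by the
  Cantor pairing function, finite sets by their binary canonical index.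
\<close>

definition enum_reducible :: "nat set \<Rightarrow> nat set \<Rightarrow> bool" (infix "\<le>\<^sub>e" 50) where
  "A \<le>\<^sub>e B \<longleftrightarrow> (\<exists>W. comp_enumerable W \<and>
     A = {x. \<exists>D. finite D \<and> D \<subseteq> B \<and> prod_encode (x, set_encode D) \<in> W})"

definition enum_equiv :: "(nat set \<times> nat set) set" where
  "enum_equiv = {(A, B). A \<le>\<^sub>e B \<and> B \<le>\<^sub>e A}"

type_synonym degree = "nat set set"

definition enum_degrees :: "degree set" where
  "enum_degrees = UNIV // enum_equiv"

definition edeg :: "nat set \<Rightarrow> degree" where
  "edeg A = enum_equiv `` {A}"

definition tuple :: "nat set list \<Rightarrow> nat set" where
  "tuple As = {prod_encode (i, x) | i x. i < length As \<and> x \<in> As ! i}"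

text \<open>
  The degree of the tuple of representatives, one from each factor. It does not depend on the
  representatives, so all members of the union coincide. The empty product is the least degree,
  that of the c.e. sets.
\<close>

definition edeg_prod :: "degree list \<Rightarrow> degree" where
  "edeg_prod ds = (\<Union>As\<in>listset ds. edeg (tuple As))"


section \<open>Semirecursive and Turing degrees\<close>

definition semirecursive :: "nat set \<Rightarrow> bool" where
  "semirecursive A \<longleftrightarrow> (\<exists>f. computable2 f \<and>
     (\<forall>n m. f n m \<in> {n, m} \<and> (n \<in> A \<or> m \<in> A \<longrightarrow> f n m \<in> A)))"

definition semirecursive_degree :: "degree \<Rightarrow> bool" where
  "semirecursive_degree d \<longleftrightarrow> (\<exists>A. semirecursive A \<and> d = edeg A)"

definition set_join :: "nat set \<Rightarrow> nat set \<Rightarrow> nat set" (infixr "\<oplus>" 65) where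
  "A \<oplus> B = (\<lambda>x. 2 * x) ` A \<union> (\<lambda>x. 2 * x + 1) ` B"

text \<open>
  Turing degrees are identified with their images under the embedding of the Turing degrees into
  the enumeration degrees induced by \<open>A \<mapsto> A \<oplus> - A\<close>.
\<close>

definition Turing_degree :: "degree \<Rightarrow> bool" where
  "Turing_degree d \<longleftrightarrow> (\<exists>A. d = edeg (A \<oplus> - A))"

definition prod_semirec :: "nat \<Rightarrow> degree \<Rightarrow> bool" where
  "prod_semirec k d \<longleftrightarrow> (\<exists>ds. length ds = k \<and> (\<forall>e\<in>set ds. semirecursive_degree e) \<and>
     d = edeg_prod ds)"

definition prod_semirec_Turing :: "nat \<Rightarrow> degree \<Rightarrow> bool" where
  "prod_semirec_Turing k d \<longleftrightarrow> (\<exists>ds t. length ds = k \<and> (\<forall>e\<in>set ds. semirecursive_degree e) \<and>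
     Turing_degree t \<and> d = edeg_prod (ds @ [t]))"

end

(*
Enumeration operators are monotone, and two sets with the same selector function are comparable
under inclusion. Hence, when the left cuts of x in R^k are equivalent to a tuple of semirecursive
sets with fixed selectors (plus possibly a set C join its complement), for x ranging over a set X
and for a fixed pair of operators, X is order-embedded into a product of chains (and an antichain).
A somewhere dense X contains the standard example of a k-dimensional order together with an upper
bound. The upper bound makes the antichain component constant, so at least k chains are needed; by
Baire some x in R^k avoids the countably many nowhere dense sets X arising from fewer chains.

For the remaining claim, fix a parameter C as Turing part and compare with k + 1 chains. If X is
somewhere dense, the embedding strictly increases at least k of the chains between two points of X,
which is witnessed by finitely many numbers. Two parameters with the same witnesses would have to
pass each other in the single remaining chain, so only countably many C are bad, and any other C
works with a generic x.
*)

theory Submission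
  imports Defs "HOL-Analysis.Analysis"
begin

section \<open>Computable functions and relations\<close>

text \<open>The length is fixed because a program accepts argument lists of every length; values of
  \<open>f\<close> on other lists are unconstrained.\<close>

definition recfn :: "nat \<Rightarrow> (nat list \<Rightarrow> nat) \<Rightarrow> bool" where
  "recfn k f \<longleftrightarrow> (\<exists>p. \<forall>xs. length xs = k \<longrightarrow> computes p xs (f xs))"

definition recrel :: "nat \<Rightarrow> (nat list \<Rightarrow> bool) \<Rightarrow> bool" where
  "recrel k P \<longleftrightarrow> recfn k (\<lambda>xs. of_bool (P xs))"

lemma recfn_cong:
  "(\<And>xs. length xs = k \<Longrightarrow> f xs = g xs) \<Longrightarrow> recfn k f \<longleftrightarrow> recfn k g"
  by (simp add: recfn_def)

lemma recfn_comp: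
  assumes "recfn (length gs) f" "\<And>g. g \<in> set gs \<Longrightarrow> recfn k g"
  shows "recfn k (\<lambda>xs. f (map (\<lambda>g. g xs) gs))"
proof -
  from assms(1) obtain p where p: "\<And>ys. length ys = length gs \<Longrightarrow> computes p ys (f ys)"
    by (auto simp: recfn_def)
  from assms(2) obtain q where
    q: "\<And>g xs. g \<in> set gs \<Longrightarrow> length xs = k \<Longrightarrow> computes (q g) xs (g xs)"
    unfolding recfn_def by metis
  have "computes (Comp p (map q gs)) xs (f (map (\<lambda>g. g xs) gs))" if "length xs = k" for xs
    by (rule computes.Comp[OF _ p]) (auto simp: list_all2_conv_all_nth q that)
  then show ?thesis by (auto simp: recfn_def)
qed

lemma recfn_nth: "i < k \<Longrightarrow> recfn k (\<lambda>xs. xs ! i)"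
  unfolding recfn_def by (metis computes.Proj)

lemma recfn_Suc:
  assumes "recfn k f"
  shows "recfn k (\<lambda>xs. Suc (f xs))"
proof -
  have "recfn (length [f]) (\<lambda>xs. Suc (hd xs))"
    unfolding recfn_def
    by (rule exI[of _ Succ]) (auto simp: length_Suc_conv intro: computes.Succ)
  from recfn_comp[OF this] assms show ?thesis by simp
qed

lemma recfn_const: "recfn k (\<lambda>_. c)"
proof (induction c)
  case 0
  then show ?case unfolding recfn_def by (metis computes.Zero)
qed (rule recfn_Suc)

lemma recfn_comp1:
  assumes "recfn 1 (\<lambda>xs. f (xs ! 0))" "recfn k g"
  shows "recfn k (\<lambda>xs. f (g xs))"
  using recfn_comp[of "[g]" "\<lambda>xs. f (xs ! 0)"] assms by simp

lemma recfn_comp2: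
  assumes "recfn 2 (\<lambda>xs. f (xs ! 0) (xs ! 1))" "recfn k g" "recfn k h"
  shows "recfn k (\<lambda>xs. f (g xs) (h xs))"
  using recfn_comp[of "[g, h]" "\<lambda>xs. f (xs ! 0) (xs ! 1)"] assms
  by (auto simp: numeral_2_eq_2)

lemma recrel_comp2:
  assumes "recrel 2 (\<lambda>xs. P (xs ! 0) (xs ! 1))" "recfn k g" "recfn k h"
  shows "recrel k (\<lambda>xs. P (g xs) (h xs))"
  using recfn_comp2[of "\<lambda>x y. of_bool (P x y)"] assms by (simp add: recrel_def)

lemma recfn_rename:
  assumes "recfn m f" "\<And>i. i < m \<Longrightarrow> h i < k"
  shows "recfn k (\<lambda>xs. f (map (\<lambda>i. xs ! h i) [0..<m]))"
proof -
  have "recfn k (\<lambda>xs. f (map (\<lambda>g. g xs) (map (\<lambda>i xs. xs ! h i) [0..<m])))"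
    using assms by (intro recfn_comp) (auto intro: recfn_nth)
  then show ?thesis by (simp add: comp_def)
qed

lemma map_nth_Suc_tl: "length xs = Suc k \<Longrightarrow> map (\<lambda>i. xs ! Suc i) [0..<k] = tl xs"
  by (auto intro!: nth_equalityI simp: nth_tl)

lemma recfn_tl:
  assumes "recfn k f"
  shows "recfn (Suc k) (\<lambda>xs. f (tl xs))"
proof -
  have "recfn (Suc k) (\<lambda>xs. f (map (\<lambda>i. xs ! Suc i) [0..<k]))"
    using assms by (rule recfn_rename) simp
  then show ?thesis by (simp add: map_nth_Suc_tl cong: recfn_cong)
qed

lemma recfn_Cons:
  assumes "recfn (Suc k) f" "recfn k g"
  shows "recfn k (\<lambda>xs. f (g xs # xs))"
proof -
  have "recfn k (\<lambda>xs. f (map (\<lambda>h. h xs) (g # map (\<lambda>i xs. xs ! i) [0..<k])))"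
    using assms by (intro recfn_comp) (auto simp: recfn_nth)
  moreover have "map (\<lambda>h. h xs) (g # map (\<lambda>i xs. xs ! i) [0..<k]) = g xs # xs"
    if "length xs = k" for xs
    using that by (auto simp: comp_def intro: nth_equalityI)
  ultimately show ?thesis by (simp cong: recfn_cong)
qed

text \<open>The step function finds the counter and the previous value in front of the arguments,
  the order in which \<open>PrimRec\<close> supplies them.\<close>

lemma recfn_rec_nat:
  assumes f: "recfn k f" and g: "recfn (Suc (Suc k)) (\<lambda>zs. g (hd zs) (hd (tl zs)) (tl (tl zs)))"
    and h: "recfn k h"
  shows "recfn k (\<lambda>xs. rec_nat (f xs) (\<lambda>n y. g n y xs) (h xs))"
proof -
  from f obtain p where p: "\<And>xs. length xs = k \<Longrightarrow> computes p xs (f xs)"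
    by (auto simp: recfn_def)
  from g obtain q where
    q: "length zs = Suc (Suc k) \<Longrightarrow> computes q zs (g (hd zs) (hd (tl zs)) (tl (tl zs)))" for zs
    by (auto simp: recfn_def)
  have q': "length xs = k \<Longrightarrow> computes q (n # y # xs) (g n y xs)" for n y xs
    using q[of "n # y # xs"] by simp
  have "computes (PrimRec p q) (n # xs) (rec_nat (f xs) (\<lambda>n y. g n y xs) n)"
    if "length xs = k" for n xs
    using that by (induction n) (auto intro: computes.intros p q')
  then have "recfn (Suc k) (\<lambda>zs. rec_nat (f (tl zs)) (\<lambda>n y. g n y (tl zs)) (hd zs))"
    by (auto simp: recfn_def length_Suc_conv intro!: exI[of _ "PrimRec p q"])
  from recfn_Cons[OF this h] show ?thesis by simp
qed

lemma recfn_hd: "0 < k \<Longrightarrow> recfn k hd"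
  using recfn_nth[of 0 k] by (subst recfn_cong[of _ _ "\<lambda>xs. xs ! 0"]) (auto simp: hd_conv_nth)

lemma recfn_hd_tl: "Suc 0 < k \<Longrightarrow> recfn k (\<lambda>xs. hd (tl xs))"
  using recfn_tl[OF recfn_hd, of "k - 1"] by simp

lemma recfn_hd_tl2: "Suc (Suc 0) < k \<Longrightarrow> recfn k (\<lambda>xs. hd (tl (tl xs)))"
  using recfn_tl[OF recfn_hd_tl, of "k - 1"] by simp

lemma recfn_tl_nth: "Suc i < k \<Longrightarrow> recfn k (\<lambda>xs. tl xs ! i)"
  using recfn_tl[OF recfn_nth[of i], of "k - 1"] by simp

lemma recfn_tl2_nth: "Suc (Suc i) < k \<Longrightarrow> recfn k (\<lambda>xs. tl (tl xs) ! i)"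
  using recfn_tl[OF recfn_tl_nth[of i], of "k - 1"] by simp

lemma recfn_tl3_nth: "Suc (Suc (Suc i)) < k \<Longrightarrow> recfn k (\<lambda>xs. tl (tl (tl xs)) ! i)"
  using recfn_tl[OF recfn_tl2_nth[of i], of "k - 1"] by simp

text \<open>Each recursion or bounded quantifier pushes an entry onto the argument list, so an outer
  variable reappears behind one more \<open>tl\<close>. These are the forms met up to three levels
  deep.\<close>

lemmas recfn_vars = recfn_nth recfn_hd recfn_hd_tl recfn_hd_tl2
  recfn_tl_nth recfn_tl2_nth recfn_tl3_nth

section \<open>Arithmetic, decidable relations, bounded quantifiers and search\<close>

lemma recfn_add:
  assumes "recfn k f" "recfn k g"
  shows "recfn k (\<lambda>xs. f xs + g xs)"
proof (rule recfn_comp2[OF _ assms])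
  have "rec_nat m (\<lambda>_. Suc) n = m + n" for m n by (induction n) auto
  moreover have "recfn 2 (\<lambda>xs. rec_nat (xs ! 0) (\<lambda>_. Suc) (xs ! 1))"
    by (intro recfn_rec_nat recfn_Suc recfn_vars) simp_all
  ultimately show "recfn 2 (\<lambda>xs. xs ! 0 + xs ! 1)" by simp
qed

lemma recfn_mult:
  assumes "recfn k f" "recfn k g"
  shows "recfn k (\<lambda>xs. f xs * g xs)"
proof (rule recfn_comp2[OF _ assms])
  have "rec_nat 0 (\<lambda>_ y. y + m) n = m * n" for m n :: nat by (induction n) auto
  moreover have "recfn 2 (\<lambda>xs. rec_nat 0 (\<lambda>_ y. y + xs ! 0) (xs ! 1))"
    by (intro recfn_rec_nat recfn_add recfn_vars recfn_const) simp_all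
  ultimately show "recfn 2 (\<lambda>xs. xs ! 0 * xs ! 1)" by simp
qed

lemma recfn_power:
  assumes "recfn k f" "recfn k g"
  shows "recfn k (\<lambda>xs. f xs ^ g xs)"
proof (rule recfn_comp2[OF _ assms])
  have "rec_nat 1 (\<lambda>_ y. y * m) n = m ^ n" for m n :: nat by (induction n) auto
  moreover have "recfn 2 (\<lambda>xs. rec_nat 1 (\<lambda>_ y. y * xs ! 0) (xs ! 1))"
    by (intro recfn_rec_nat recfn_mult recfn_vars recfn_const) simp_all
  ultimately show "recfn 2 (\<lambda>xs. xs ! 0 ^ xs ! 1)" by simp
qed

lemma recfn_diff:
  assumes "recfn k f" "recfn k g"
  shows "recfn k (\<lambda>xs. f xs - g xs)"
proof (rule recfn_comp2[OF _ assms])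
  \<comment> \<open>Predecessor: the recursion returns its counter and forgets the previous
    value.\<close>
  have *: "rec_nat 0 (\<lambda>n _. n) n = n - 1" for n :: nat by (cases n) auto
  have "recfn 1 (\<lambda>xs. rec_nat 0 (\<lambda>n _. n) (xs ! 0))"
    by (intro recfn_rec_nat recfn_vars recfn_const) simp_all
  then have pred: "recfn 1 (\<lambda>xs. xs ! 0 - 1)" by (simp add: *)
  have "rec_nat m (\<lambda>_ y. y - 1) n = m - n" for m n :: nat by (induction n) auto
  moreover have "recfn 2 (\<lambda>xs. rec_nat (xs ! 0) (\<lambda>_ y. y - 1) (xs ! 1))"
    by (intro recfn_rec_nat recfn_comp1[OF pred] recfn_vars) simp_all
  ultimately show "recfn 2 (\<lambda>xs. xs ! 0 - xs ! 1)" by simp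
qed

lemma recrel_le:
  assumes "recfn k f" "recfn k g"
  shows "recrel k (\<lambda>xs. f xs \<le> g xs)"
proof -
  have "recfn k (\<lambda>xs. 1 - (f xs - g xs))"
    using assms by (intro recfn_diff recfn_const)
  moreover have "1 - (m - n) = of_bool (m \<le> n)" for m n :: nat by simp
  ultimately show ?thesis by (simp add: recrel_def)
qed

lemma recrel_not:
  assumes "recrel k P"
  shows "recrel k (\<lambda>xs. \<not> P xs)"
proof -
  have "recfn k (\<lambda>xs. 1 - of_bool (P xs))"
    using assms by (intro recfn_diff recfn_const) (simp add: recrel_def)
  moreover have "1 - of_bool p = (of_bool (\<not> p) :: nat)" for p by simp
  ultimately show ?thesis by (simp add: recrel_def)
qed

lemma recrel_conj:
  assumes "recrel k P" "recrel k Q"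
  shows "recrel k (\<lambda>xs. P xs \<and> Q xs)"
  using recfn_mult[of k "\<lambda>xs. of_bool (P xs)" "\<lambda>xs. of_bool (Q xs)"] assms
  by (simp add: recrel_def of_bool_conj)

lemma recrel_disj: "recrel k P \<Longrightarrow> recrel k Q \<Longrightarrow> recrel k (\<lambda>xs. P xs \<or> Q xs)"
  using recrel_not[OF recrel_conj[OF recrel_not recrel_not]] by simp

lemma recrel_imp: "recrel k P \<Longrightarrow> recrel k Q \<Longrightarrow> recrel k (\<lambda>xs. P xs \<longrightarrow> Q xs)"
  unfolding imp_conv_disj by (intro recrel_disj recrel_not)

lemma recrel_eq: "recfn k f \<Longrightarrow> recfn k g \<Longrightarrow> recrel k (\<lambda>xs. f xs = g xs)"
  unfolding order_eq_iff by (intro recrel_conj recrel_le)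

lemma recfn_If:
  assumes "recrel k P" "recfn k f" "recfn k g"
  shows "recfn k (\<lambda>xs. if P xs then f xs else g xs)"
proof -
  have "recfn k (\<lambda>xs. of_bool (P xs) * f xs + of_bool (\<not> P xs) * g xs)"
    using assms recrel_not[OF assms(1)]
    by (intro recfn_add recfn_mult) (simp_all add: recrel_def)
  moreover have "of_bool (P xs) * f xs + of_bool (\<not> P xs) * g xs = (if P xs then f xs else g xs)"
    for xs by simp
  ultimately show ?thesis by (simp only:)
qed

text \<open>Primitive recursion up to the bound carries a flag that becomes 1 at the first witness
  and stays 1.\<close>

lemma recrel_ex:
  assumes P: "recrel (Suc k) (\<lambda>zs. P (hd zs) (tl zs))" and f: "recfn k f"
  shows "recrel k (\<lambda>xs. \<exists>y<f xs. P y xs)"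
proof -
  define g where "g n y xs = (if y = 1 \<or> P n xs then 1 else 0 :: nat)" for n y :: nat and xs
  \<comment> \<open>The recursion step sees counter, flag and arguments. The renaming of positions
    skips the flag, which \<open>P\<close> must not see.\<close>
  have "recfn (Suc (Suc k))
      (\<lambda>zs. of_bool (P (hd (map (\<lambda>i. zs ! (if i = 0 then 0 else Suc i)) [0..<Suc k]))
                       (tl (map (\<lambda>i. zs ! (if i = 0 then 0 else Suc i)) [0..<Suc k]))))"
    using P unfolding recrel_def
    by (rule recfn_rename[where h = "\<lambda>i. if i = 0 then 0 else Suc i"]) auto
  moreover have "hd (map (\<lambda>i. zs ! (if i = 0 then 0 else Suc i)) [0..<Suc k]) = hd zs"
    and "tl (map (\<lambda>i. zs ! (if i = 0 then 0 else Suc i)) [0..<Suc k]) = tl (tl zs)"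
    if "length zs = Suc (Suc k)" for zs :: "nat list"
    using that
    by (cases zs; cases "tl zs"; auto simp: map_tl[symmetric] upt_conv_Cons nth_tl
          simp del: upt_Suc intro!: nth_equalityI)+
  ultimately have "recrel (Suc (Suc k)) (\<lambda>zs. P (hd zs) (tl (tl zs)))"
    unfolding recrel_def by (simp cong: recfn_cong)
  then have "recfn k (\<lambda>xs. rec_nat 0 (\<lambda>n y. g n y xs) (f xs))"
    unfolding g_def
    by (intro recfn_rec_nat recfn_If recrel_disj recrel_eq recfn_const recfn_vars f) simp_all
  moreover have "rec_nat 0 (\<lambda>n y. g n y xs) m = of_bool (\<exists>y<m. P y xs)" for m xs
    by (induction m) (auto simp: g_def less_Suc_eq)
  ultimately show ?thesis by (simp add: recrel_def)
qed

lemma recrel_all: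
  "recrel (Suc k) (\<lambda>zs. P (hd zs) (tl zs)) \<Longrightarrow> recfn k f \<Longrightarrow> recrel k (\<lambda>xs. \<forall>y<f xs. P y xs)"
  using recrel_not[OF recrel_ex[of k "\<lambda>y xs. \<not> P y xs" f]] recrel_not by simp

text \<open>Unbounded search: the characteristic function of the complement of the graph vanishes
  exactly at the value, which exists because \<open>f\<close> is total. This inverts the pairing
  function below.\<close>

lemma recfn_graph:
  assumes "recrel (Suc k) (\<lambda>zs. f (tl zs) = hd zs)"
  shows "recfn k f"
proof -
  from recrel_not[OF assms] obtain p where
    p: "computes p zs (of_bool (f (tl zs) \<noteq> hd zs))" if "length zs = Suc k" for zs
    by (auto simp: recrel_def recfn_def)
  have "computes (Minim p) xs (f xs)" if "length xs = k" for xs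
  proof (rule computes.Minim)
    show "computes p (f xs # xs) 0" using p[of "f xs # xs"] that by simp
    show "\<forall>z<f xs. \<exists>v. computes p (z # xs) (Suc v)"
    proof (intro allI impI exI)
      fix z assume "z < f xs"
      then show "computes p (z # xs) (Suc 0)" using p[of "z # xs"] that by simp
    qed
  qed
  then show ?thesis by (auto simp: recfn_def)
qed

section \<open>Codes of pairs and of finite sets\<close>

lemma recfn_triangle:
  assumes "recfn k f"
  shows "recfn k (\<lambda>xs. triangle (f xs))"
proof (rule recfn_comp1[OF _ assms])
  have "rec_nat 0 (\<lambda>n y. y + Suc n) m = triangle m" for m by (induction m) auto
  moreover have "recfn 1 (\<lambda>xs. rec_nat 0 (\<lambda>n y. y + Suc n) (xs ! 0))"
    by (intro recfn_rec_nat recfn_add recfn_Suc recfn_vars recfn_const) simp_all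
  ultimately show "recfn 1 (\<lambda>xs. triangle (xs ! 0))" by simp
qed

lemma recfn_prod_encode:
  "recfn k f \<Longrightarrow> recfn k g \<Longrightarrow> recfn k (\<lambda>xs. prod_encode (f xs, g xs))"
  unfolding prod_encode_def by (simp add: recfn_add recfn_triangle)

text \<open>A component never exceeds the code of the pair, so the graph is defined by a bounded
  search for the other component.\<close>

lemma recfn_fst_decode:
  assumes "recfn k f"
  shows "recfn k (\<lambda>xs. fst (prod_decode (f xs)))"
proof (rule recfn_comp1[OF _ assms], rule recfn_graph)
  have "fst (prod_decode u) = a \<longleftrightarrow> (\<exists>b<Suc u. prod_encode (a, b) = u)" for a u
    by (metis fst_conv le_imp_less_Suc le_prod_encode_2 prod.collapse prod_decode_inverse
        prod_encode_inverse)
  moreover have "recrel (Suc 1) (\<lambda>zs. \<exists>b<Suc (tl zs ! 0). prod_encode (hd zs, b) = tl zs ! 0)"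
    by (intro recrel_ex recrel_eq recfn_prod_encode recfn_Suc recfn_vars) simp_all
  ultimately show "recrel (Suc 1) (\<lambda>zs. fst (prod_decode (tl zs ! 0)) = hd zs)"
    by simp
qed

lemma recfn_snd_decode:
  assumes "recfn k f"
  shows "recfn k (\<lambda>xs. snd (prod_decode (f xs)))"
proof (rule recfn_comp1[OF _ assms], rule recfn_graph)
  have "snd (prod_decode u) = b \<longleftrightarrow> (\<exists>a<Suc u. prod_encode (a, b) = u)" for b u
    by (metis snd_conv le_imp_less_Suc le_prod_encode_1 prod.collapse prod_decode_inverse
        prod_encode_inverse)
  moreover have "recrel (Suc 1) (\<lambda>zs. \<exists>a<Suc (tl zs ! 0). prod_encode (a, hd zs) = tl zs ! 0)"
    by (intro recrel_ex recrel_eq recfn_prod_encode recfn_Suc recfn_vars) simp_all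
  ultimately show "recrel (Suc 1) (\<lambda>zs. snd (prod_decode (tl zs ! 0)) = hd zs)"
    by simp
qed

text \<open>Bit \<open>i\<close> of \<open>d\<close> is 1, written with bounded quantifiers, sums,
  products and powers so that the closure rules apply.\<close>

lemma mem_set_decode_iff:
  "i \<in> set_decode d \<longleftrightarrow> (\<exists>a<Suc d. \<exists>b<2 ^ i. d = (2 * a + 1) * 2 ^ i + b)"
proof
  assume "i \<in> set_decode d"
  then have "odd (d div 2 ^ i)" by (simp add: set_decode_def)
  then obtain a where a: "d div 2 ^ i = 2 * a + 1" by (rule oddE)
  have "d = (2 * a + 1) * 2 ^ i + d mod 2 ^ i" unfolding a[symmetric] by (metis div_mult_mod_eq)
  moreover have "a < Suc d" using a div_le_dividend[of d "2 ^ i"] by linarith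
  ultimately show "\<exists>a<Suc d. \<exists>b<2 ^ i. d = (2 * a + 1) * 2 ^ i + b"
    by (meson mod_less_divisor zero_less_numeral zero_less_power)
next
  assume "\<exists>a<Suc d. \<exists>b<2 ^ i. d = (2 * a + 1) * 2 ^ i + b"
  then obtain a b where "b < 2 ^ i" "d = b + (2 * a + 1) * 2 ^ i" by auto
  then have "d div 2 ^ i = 2 * a + 1" by (simp only: div_mult_self1) simp
  then show "i \<in> set_decode d" by (simp add: set_decode_def)
qed

lemma recrel_mem_set_decode:
  assumes "recfn k f" "recfn k g"
  shows "recrel k (\<lambda>xs. f xs \<in> set_decode (g xs))"
proof (rule recrel_comp2[OF _ assms])
  show "recrel 2 (\<lambda>xs. xs ! 0 \<in> set_decode (xs ! 1))"
    unfolding mem_set_decode_iff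
    by (intro recrel_ex recrel_eq recfn_add recfn_mult recfn_power recfn_Suc recfn_const recfn_vars)
      simp_all
qed

lemma mem_set_decode_less:
  assumes "i \<in> set_decode d"
  shows "i < d"
proof (rule ccontr)
  assume "\<not> i < d"
  then have "d < 2 ^ i" using less_exp[of i] by linarith
  with assms show False by (simp add: set_decode_def)
qed

lemma recrel_subset_set_decode:
  assumes "recfn k f" "recfn k g"
  shows "recrel k (\<lambda>xs. set_decode (f xs) \<subseteq> set_decode (g xs))"
proof (rule recrel_comp2[OF _ assms])
  have "set_decode d \<subseteq> set_decode e \<longleftrightarrow> (\<forall>i<d. i \<in> set_decode d \<longrightarrow> i \<in> set_decode e)" for d e
    using mem_set_decode_less by blast
  moreover have "recrel 2 (\<lambda>xs. \<forall>i<xs ! 0. i \<in> set_decode (xs ! 0) \<longrightarrow> i \<in> set_decode (xs ! 1))"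
    by (intro recrel_all recrel_imp recrel_mem_set_decode recfn_vars) simp_all
  ultimately show "recrel 2 (\<lambda>xs. set_decode (xs ! 0) \<subseteq> set_decode (xs ! 1))" by simp
qed

section \<open>Enumeration reducibility\<close>

lemma recrel_const: "recrel k (\<lambda>_. P)"
  unfolding recrel_def by (rule recfn_const)

text \<open>Here the bound is a fixed number and not an argument, so the relations
  \<open>P i\<close> need not be uniform in \<open>i\<close>. This allows an unrelated operator for
  each component of a tuple.\<close>

lemma recrel_finite_ex:
  fixes n :: nat
  shows "(\<And>i. i < n \<Longrightarrow> recrel k (P i)) \<Longrightarrow> recrel k (\<lambda>xs. \<exists>i<n. P i xs)"
proof (induction n)
  case (Suc n)
  then have "recrel k (\<lambda>xs. (\<exists>i<n. P i xs) \<or> P n xs)"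
    by (intro recrel_disj) simp_all
  then show ?case by (simp add: less_Suc_eq ex_disj_distrib conj_disj_distribR)
qed (simp add: recrel_const)

lemma recrel_comp3:
  assumes "recrel 3 (\<lambda>xs. P (xs ! 0) (xs ! 1) (xs ! 2))" "recfn k f" "recfn k g" "recfn k h"
  shows "recrel k (\<lambda>xs. P (f xs) (g xs) (h xs))"
  using recfn_comp[of "[f, g, h]" "\<lambda>xs. of_bool (P (xs ! 0) (xs ! 1) (xs ! 2))"] assms
  by (auto simp: recrel_def numeral_2_eq_2 numeral_3_eq_3)

lemma computable1_iff: "computable1 f \<longleftrightarrow> recfn 1 (\<lambda>xs. f (xs ! 0))"
proof
  assume "computable1 f"
  then obtain p where "\<And>x. computes p [x] (f x)" by (auto simp: computable1_def)
  then show "recfn 1 (\<lambda>xs. f (xs ! 0))"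
    unfolding recfn_def by (intro exI[of _ p]) (auto simp: length_Suc_conv)
next
  assume "recfn 1 (\<lambda>xs. f (xs ! 0))"
  then obtain p where "\<And>xs. length xs = 1 \<Longrightarrow> computes p xs (f (xs ! 0))"
    by (auto simp: recfn_def)
  from this[of "[x]" for x] show "computable1 f" by (auto simp: computable1_def)
qed

lemma computable2I:
  assumes "recfn 2 (\<lambda>xs. f (xs ! 0) (xs ! 1))"
  shows "computable2 f"
proof -
  from assms obtain p where "\<And>xs. length xs = 2 \<Longrightarrow> computes p xs (f (xs ! 0) (xs ! 1))"
    by (auto simp: recfn_def)
  from this[of "[x, y]" for x y] show "computable2 f" by (auto simp: computable2_def)
qed

section \<open>Computably enumerable sets as projections, and enumeration operators\<close>

lemma comp_enumerable_iff:
  "comp_enumerable W \<longleftrightarrow> (\<exists>R. recrel 2 (\<lambda>xs. R (xs ! 0) (xs ! 1)) \<and> W = {x. \<exists>s. R s x})"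
proof
  assume "comp_enumerable W"
  then consider "W = {}" | f where "recfn 1 (\<lambda>xs. f (xs ! 0))" "W = range f"
    by (auto simp: comp_enumerable_def computable1_iff)
  then show "\<exists>R. recrel 2 (\<lambda>xs. R (xs ! 0) (xs ! 1)) \<and> W = {x. \<exists>s. R s x}"
  proof cases
    case 1
    then show ?thesis by (intro exI[of _ "\<lambda>_ _. False"]) (simp add: recrel_const)
  next
    case (2 f)
    have "recrel 2 (\<lambda>xs. f (xs ! 0) = xs ! 1)"
      by (intro recrel_eq recfn_comp1[OF 2(1)] recfn_vars) simp_all
    then show ?thesis using 2(2) by (intro exI[of _ "\<lambda>s x. f s = x"]) auto
  qed
next
  assume "\<exists>R. recrel 2 (\<lambda>xs. R (xs ! 0) (xs ! 1)) \<and> W = {x. \<exists>s. R s x}"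
  then obtain R where R: "recrel 2 (\<lambda>xs. R (xs ! 0) (xs ! 1))" and W: "W = {x. \<exists>s. R s x}"
    by blast
  show "comp_enumerable W"
  proof (cases "W = {}")
    case False
    then obtain a where a: "a \<in> W" by blast
    define f where "f u = (let (s, x) = prod_decode u in if R s x then x else a)" for u
    have "recfn 1 (\<lambda>xs. f (xs ! 0))"
      unfolding f_def Let_def case_prod_beta
      by (intro recfn_If recrel_comp2[OF R] recfn_fst_decode recfn_snd_decode recfn_const
            recfn_vars) simp_all
    moreover have "x \<in> range f" if "x \<in> W" for x
    proof -
      from that W obtain s where "R s x" by blast
      then have "f (prod_encode (s, x)) = x" by (simp add: f_def)
      then show ?thesis by (metis rangeI)
    qed
    moreover have "f u \<in> W" for u using a W by (auto simp: f_def split: prod.split)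
    ultimately show ?thesis by (auto simp: comp_enumerable_def computable1_iff)
  qed (simp add: comp_enumerable_def)
qed

definition enum_op :: "nat set \<Rightarrow> nat set \<Rightarrow> nat set" where
  "enum_op W B = {x. \<exists>D. finite D \<and> D \<subseteq> B \<and> prod_encode (x, set_encode D) \<in> W}"

lemma enum_reducible_iff: "A \<le>\<^sub>e B \<longleftrightarrow> (\<exists>W. comp_enumerable W \<and> A = enum_op W B)"
  by (simp add: enum_reducible_def enum_op_def)

lemma enum_op_decode: "x \<in> enum_op W B \<longleftrightarrow> (\<exists>d. set_decode d \<subseteq> B \<and> prod_encode (x, d) \<in> W)"
  unfolding enum_op_def mem_Collect_eq
  by (metis finite_set_decode set_decode_inverse set_encode_inverse)

text \<open>Axioms ask only for positive information about the oracle. All order arguments below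
  rest on this property.\<close>

lemma enum_op_mono: "B \<subseteq> C \<Longrightarrow> enum_op W B \<subseteq> enum_op W C"
  by (auto simp: enum_op_def)

lemma enum_reducibleI:
  assumes R: "recrel 3 (\<lambda>xs. R (xs ! 0) (xs ! 1) (xs ! 2))"
    and A: "\<And>x. x \<in> A \<longleftrightarrow> (\<exists>d s. set_decode d \<subseteq> B \<and> R s x d)"
  shows "A \<le>\<^sub>e B"
proof -
  define W where "W = {u. \<exists>s. R s (fst (prod_decode u)) (snd (prod_decode u))}"
  have "recrel 2 (\<lambda>xs. R (xs ! 0) (fst (prod_decode (xs ! 1))) (snd (prod_decode (xs ! 1))))"
    by (intro recrel_comp3[OF R] recfn_fst_decode recfn_snd_decode recfn_vars) simp_all
  then have "comp_enumerable W"
    unfolding comp_enumerable_iff W_def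
    by (intro exI[of _ "\<lambda>s u. R s (fst (prod_decode u)) (snd (prod_decode u))"]) simp
  moreover have "A = enum_op W B" by (auto simp: A enum_op_decode W_def)
  ultimately show ?thesis by (auto simp: enum_reducible_iff)
qed

lemma enum_reducibleD:
  assumes "A \<le>\<^sub>e B"
  shows "\<exists>R. recrel 2 (\<lambda>xs. R (xs ! 0) (xs ! 1)) \<and>
    (\<forall>x. x \<in> A \<longleftrightarrow> (\<exists>d. set_decode d \<subseteq> B \<and> (\<exists>s. R s (prod_encode (x, d)))))"
proof -
  from assms obtain W where W: "comp_enumerable W" "A = enum_op W B"
    by (auto simp: enum_reducible_iff)
  from W(1) obtain R where "recrel 2 (\<lambda>xs. R (xs ! 0) (xs ! 1))" "W = {x. \<exists>s. R s x}"
    unfolding comp_enumerable_iff by blast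
  then show ?thesis by (intro exI[of _ R]) (simp add: W(2) enum_op_decode)
qed

lemma many_one_enum_reducible:
  assumes f: "recfn 1 (\<lambda>xs. f (xs ! 0))" and A: "\<And>x. x \<in> A \<longleftrightarrow> f x \<in> B"
  shows "A \<le>\<^sub>e B"
proof (rule enum_reducibleI)
  \<comment> \<open>The axiom for \<open>x\<close> has the singleton of \<open>f x\<close> as its
    finite set, with canonical index \<open>2 ^ f x\<close>.\<close>
  show "recrel 3 (\<lambda>xs. xs ! 2 = 2 ^ f (xs ! 1))"
    by (intro recrel_eq recfn_power recfn_comp1[OF f] recfn_const recfn_vars) simp_all
  have "set_decode (2 ^ y) = {y}" for y
    using set_encode_inverse[of "{y}"] by (simp add: set_encode_def)
  then show "x \<in> A \<longleftrightarrow> (\<exists>d (s::nat). set_decode d \<subseteq> B \<and> d = 2 ^ f x)" for x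
    by (simp add: A)
qed

lemma enum_reducible_refl: "A \<le>\<^sub>e A"
  by (rule many_one_enum_reducible[where f = "\<lambda>x. x"]) (simp_all add: recfn_nth)

text \<open>A composite axiom consists of an axiom of the first operator and, for each element of
  its finite set, an axiom of the second. One stage \<open>t\<close> bounds all of these data, which
  makes the relation \<open>T\<close> decidable.\<close>

lemma enum_reducible_trans:
  assumes "A \<le>\<^sub>e B" "B \<le>\<^sub>e C"
  shows "A \<le>\<^sub>e C"
proof -
  from enum_reducibleD[OF assms(1)] obtain R where R: "recrel 2 (\<lambda>xs. R (xs ! 0) (xs ! 1))"
    and A: "\<And>x. x \<in> A \<longleftrightarrow> (\<exists>d. set_decode d \<subseteq> B \<and> (\<exists>s. R s (prod_encode (x, d))))"
    by blast
  from enum_reducibleD[OF assms(2)] obtain S where S: "recrel 2 (\<lambda>xs. S (xs ! 0) (xs ! 1))"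
    and B: "\<And>x. x \<in> B \<longleftrightarrow> (\<exists>d. set_decode d \<subseteq> C \<and> (\<exists>s. S s (prod_encode (x, d))))"
    by blast
  define T where "T t x d \<longleftrightarrow> (\<exists>e<t. (\<exists>s<t. R s (prod_encode (x, e))) \<and>
    (\<forall>y<t. y \<in> set_decode e \<longrightarrow>
      (\<exists>c<t. (\<exists>s<t. S s (prod_encode (y, c))) \<and> set_decode c \<subseteq> set_decode d)))" for t x d
  show ?thesis
  proof (rule enum_reducibleI)
    show "recrel 3 (\<lambda>xs. T (xs ! 0) (xs ! 1) (xs ! 2))"
      unfolding T_def
      by (intro recrel_ex recrel_all recrel_conj recrel_imp recrel_comp2[OF R] recrel_comp2[OF S]
          recfn_prod_encode recrel_mem_set_decode recrel_subset_set_decode recfn_vars)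
        simp_all
  next
    fix x
    show "x \<in> A \<longleftrightarrow> (\<exists>d t. set_decode d \<subseteq> C \<and> T t x d)"
    proof
      assume "x \<in> A"
      then obtain e s where e: "set_decode e \<subseteq> B" "R s (prod_encode (x, e))"
        by (auto simp: A)
      then have "\<forall>y\<in>set_decode e. \<exists>c s. set_decode c \<subseteq> C \<and> S s (prod_encode (y, c))"
        using B by blast
      then obtain c r where c: "\<And>y. y \<in> set_decode e \<Longrightarrow> set_decode (c y) \<subseteq> C"
        "\<And>y. y \<in> set_decode e \<Longrightarrow> S (r y) (prod_encode (y, c y))"
        by metis
      \<comment> \<open>The composite axiom asks for everything that the chosen axioms of the second
        operator ask for.\<close>
      define D where "D = (\<Union>y\<in>set_decode e. set_decode (c y))"
      have "finite D" by (simp add: D_def)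
      then have dD: "set_decode (set_encode D) = D" by (rule set_encode_inverse)
      have "finite ({e, s} \<union> c ` set_decode e \<union> r ` set_decode e)" by simp
      then obtain t where t: "\<forall>n\<in>{e, s} \<union> c ` set_decode e \<union> r ` set_decode e. n < t"
        unfolding finite_nat_set_iff_bounded ..
      have "T t x (set_encode D)"
        unfolding T_def dD
      proof (rule exI[of _ e], intro conjI allI impI)
        show "e < t" "\<exists>s<t. R s (prod_encode (x, e))" using t e by auto
        fix y assume y: "y \<in> set_decode e"
        have "set_decode (c y) \<subseteq> D" using y by (auto simp: D_def)
        with y show "\<exists>c<t. (\<exists>s<t. S s (prod_encode (y, c))) \<and> set_decode c \<subseteq> D"
          using t c(2)[OF y] by blast
      qed
      moreover have "D \<subseteq> C" using c by (auto simp: D_def)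
      ultimately show "\<exists>d t. set_decode d \<subseteq> C \<and> T t x d" using dD by metis
    next
      assume "\<exists>d t. set_decode d \<subseteq> C \<and> T t x d"
      then obtain d t where d: "set_decode d \<subseteq> C" and "T t x d" by blast
      then obtain e s where e: "e < t" "R s (prod_encode (x, e))"
        and y: "\<And>y. y < t \<Longrightarrow> y \<in> set_decode e \<Longrightarrow>
          \<exists>c s. S s (prod_encode (y, c)) \<and> set_decode c \<subseteq> set_decode d"
        unfolding T_def by blast
      have "set_decode e \<subseteq> B"
      proof
        fix z assume z: "z \<in> set_decode e"
        \<comment> \<open>Elements of a finite set lie below its index, so the bound
          \<open>y < t\<close> in \<open>T\<close> covers all of
          \<open>set_decode e\<close>.\<close>
        then have "z < t" using e(1) mem_set_decode_less by fastforce
        from y[OF this z] d show "z \<in> B" unfolding B by (meson order_trans)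
      qed
      with e show "x \<in> A" unfolding A by blast
    qed
  qed
qed

section \<open>Tuples as joins, and products of degrees\<close>

lemma mem_tuple_iff:
  "x \<in> tuple As \<longleftrightarrow>
    fst (prod_decode x) < length As \<and> snd (prod_decode x) \<in> As ! fst (prod_decode x)"
  by (auto simp: tuple_def) (metis prod.collapse prod_decode_inverse)

lemma prod_encode_mem_tuple: "prod_encode (i, x) \<in> tuple As \<longleftrightarrow> i < length As \<and> x \<in> As ! i"
  by (simp add: mem_tuple_iff)

lemma component_le_tuple:
  assumes "i < length As"
  shows "As ! i \<le>\<^sub>e tuple As"
proof (rule many_one_enum_reducible)
  show "recfn 1 (\<lambda>xs. prod_encode (i, xs ! 0))"
    by (intro recfn_prod_encode recfn_const recfn_vars) simp
qed (use assms in \<open>simp add: prod_encode_mem_tuple\<close>)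

text \<open>The finitely many operators merge into one, which reads off the component from the first
  half of the pair and runs the corresponding operator on the second.\<close>

lemma tuple_least:
  assumes "\<And>i. i < length As \<Longrightarrow> As ! i \<le>\<^sub>e B"
  shows "tuple As \<le>\<^sub>e B"
proof -
  have "\<forall>i<length As. \<exists>R. recrel 2 (\<lambda>xs. R (xs ! 0) (xs ! 1)) \<and>
    (\<forall>x. x \<in> As ! i \<longleftrightarrow> (\<exists>d. set_decode d \<subseteq> B \<and> (\<exists>s. R s (prod_encode (x, d)))))"
    using assms by (intro allI impI enum_reducibleD)
  then obtain R where R: "\<And>i. i < length As \<Longrightarrow> recrel 2 (\<lambda>xs. R i (xs ! 0) (xs ! 1))"
    and mem: "\<And>i x. i < length As \<Longrightarrow>
      x \<in> As ! i \<longleftrightarrow> (\<exists>d. set_decode d \<subseteq> B \<and> (\<exists>s. R i s (prod_encode (x, d))))"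
    by metis
  show ?thesis
  proof (rule enum_reducibleI)
    show "recrel 3 (\<lambda>xs. \<exists>i<length As. fst (prod_decode (xs ! 1)) = i \<and>
        R i (xs ! 0) (prod_encode (snd (prod_decode (xs ! 1)), xs ! 2)))"
      by (intro recrel_finite_ex recrel_conj recrel_eq recrel_comp2[OF R] recfn_prod_encode
          recfn_fst_decode recfn_snd_decode recfn_const recfn_vars) simp_all
    show "x \<in> tuple As \<longleftrightarrow> (\<exists>d s. set_decode d \<subseteq> B \<and> (\<exists>i<length As.
        fst (prod_decode x) = i \<and> R i s (prod_encode (snd (prod_decode x), d))))" for x
      using mem by (simp add: mem_tuple_iff) blast
  qed
qed

lemma enum_equiv_iff: "(A, B) \<in> enum_equiv \<longleftrightarrow> A \<le>\<^sub>e B \<and> B \<le>\<^sub>e A"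
  by (simp add: enum_equiv_def)

lemma equiv_enum_equiv: "equiv UNIV enum_equiv"
  by (intro equivI refl_onI symI transI)
    (auto simp: enum_equiv_iff enum_reducible_refl intro: enum_reducible_trans)

lemma edeg_eq_iff: "edeg A = edeg B \<longleftrightarrow> A \<le>\<^sub>e B \<and> B \<le>\<^sub>e A"
  using eq_equiv_class_iff[OF equiv_enum_equiv] by (simp add: edeg_def enum_equiv_iff)

lemma mem_edeg_iff: "B \<in> edeg A \<longleftrightarrow> A \<le>\<^sub>e B \<and> B \<le>\<^sub>e A"
  by (simp add: edeg_def enum_equiv_iff)

lemma edeg_in_enum_degrees: "edeg A \<in> enum_degrees"
  by (simp add: edeg_def enum_degrees_def quotientI)

lemma mem_listset_iff: "xs \<in> listset As \<longleftrightarrow> list_all2 (\<in>) xs As"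
  by (induction As arbitrary: xs) (auto simp: set_Cons_def list_all2_Cons2)

text \<open>The tuple is monotone in each component with respect to \<open>\<le>\<^sub>e\<close>, so
  all choices of representatives give one degree and the union in \<open>edeg_prod\<close>
  collapses.\<close>

lemma edeg_prod_map_edeg: "edeg_prod (map edeg As) = edeg (tuple As)"
proof -
  have le: "tuple Bs \<le>\<^sub>e tuple Cs"
    if "length Bs = length Cs" "\<And>i. i < length Cs \<Longrightarrow> Bs ! i \<le>\<^sub>e Cs ! i" for Bs Cs
    by (rule tuple_least) (use that in \<open>auto intro: enum_reducible_trans component_le_tuple\<close>)
  have "edeg (tuple Bs) = edeg (tuple As)" if "Bs \<in> listset (map edeg As)" for Bs
    using that unfolding edeg_eq_iff
    by (auto simp: mem_listset_iff list_all2_conv_all_nth mem_edeg_iff intro!: le)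
  moreover have "As \<in> listset (map edeg As)"
    by (simp add: mem_listset_iff list_all2_conv_all_nth mem_edeg_iff enum_reducible_refl)
  ultimately show ?thesis unfolding edeg_prod_def by blast
qed

section \<open>Countability\<close>

instance recf :: countable by countable_datatype

text \<open>By determinism a function is recovered from any program that computes it, and programs
  form a countable datatype.\<close>

lemma countable_computable1: "countable {f. computable1 f}"
proof (rule countable_subset)
  show "{f. computable1 f} \<subseteq> range (\<lambda>p x. THE y. computes p [x] y)"
  proof (rule subsetI, simp)
    fix f assume "computable1 f"
    then obtain p where p: "\<And>x. computes p [x] (f x)" by (auto simp: computable1_def)
    have "f = (\<lambda>x. THE y. computes p [x] y)"
      by (rule ext, rule sym, rule the_equality) (auto simp: p dest: computes_deterministic[OF p])
    then show "f \<in> range (\<lambda>p x. THE y. computes p [x] y)" by blast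
  qed
qed simp

lemma countable_computable2: "countable {f. computable2 f}"
proof (rule countable_subset)
  show "{f. computable2 f} \<subseteq> range (\<lambda>p x y. THE z. computes p [x, y] z)"
  proof (rule subsetI, simp)
    fix f assume "computable2 f"
    then obtain p where p: "\<And>x y. computes p [x, y] (f x y)" by (auto simp: computable2_def)
    have "f = (\<lambda>x y. THE z. computes p [x, y] z)"
      by (intro ext, rule sym, rule the_equality) (auto simp: p dest: computes_deterministic[OF p])
    then show "f \<in> range (\<lambda>p x y. THE z. computes p [x, y] z)" by blast
  qed
qed simp

lemma countable_comp_enumerable: "countable {W. comp_enumerable W}"
proof (rule countable_subset)
  show "{W. comp_enumerable W} \<subseteq> insert {} (range ` {f. computable1 f})"
    by (auto simp: comp_enumerable_def)
qed (simp add: countable_computable1)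

section \<open>Crowns and products of chains\<close>

definition has_crown :: "('a \<Rightarrow> 'a \<Rightarrow> bool) \<Rightarrow> nat \<Rightarrow> 'a set \<Rightarrow> bool" where
  "has_crown le k X \<longleftrightarrow> (\<exists>p\<in>X. \<exists>q\<in>X. le p q \<and> (\<exists>a b. \<forall>i<k. a i \<in> X \<and> b i \<in> X \<and>
     le p (b i) \<and> le (a i) q \<and> le (b i) q \<and> \<not> le (a i) (b i) \<and>
     (\<forall>j<k. j \<noteq> i \<longrightarrow> le (a i) (b j))))"

text \<open>A crown is the standard example of a partial order of dimension \<open>k\<close>: two critical pairs
  \<open>(a i, b i)\<close> cannot be reversed by the same linear extension.\<close>

lemma not_both_reversed:
  assumes "\<And>x y. x \<in> X \<Longrightarrow> y \<in> X \<Longrightarrow> le x y \<Longrightarrow> h x \<subseteq> h y"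
    and "a \<in> X" "b \<in> X" "a' \<in> X" "b' \<in> X" "le a b'" "le a' b"
    and "h a \<subseteq> h b \<or> h b \<subseteq> h a" "h a' \<subseteq> h b' \<or> h b' \<subseteq> h a'"
  shows "h a \<subseteq> h b \<or> h a' \<subseteq> h b'"
  using assms by blast

text \<open>A lower bound on order dimension: components below \<open>m\<close> are chains,
  component \<open>m\<close> is an antichain. Every critical pair has to be reversed in some chain,
  and by the pigeonhole principle two of them would share one.\<close>

lemma no_crown_below_dimension:
  fixes h :: "'a \<Rightarrow> nat \<Rightarrow> 'b set"
  assumes crown: "has_crown le k X" and "m < k"
    and le: "\<And>x y. x \<in> X \<Longrightarrow> y \<in> X \<Longrightarrow> le x y \<longleftrightarrow> (\<forall>j\<le>m. h x j \<subseteq> h y j)"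
    and chain: "\<And>x y j. x \<in> X \<Longrightarrow> y \<in> X \<Longrightarrow> j < m \<Longrightarrow> h x j \<subseteq> h y j \<or> h y j \<subseteq> h x j"
    and antichain: "\<And>x y. x \<in> X \<Longrightarrow> y \<in> X \<Longrightarrow> h x m \<subseteq> h y m \<Longrightarrow> h x m = h y m"
  shows False
proof -
  from crown obtain p q a b where pq: "p \<in> X" "q \<in> X" "le p q"
    and crown': "\<forall>i<k. a i \<in> X \<and> b i \<in> X \<and> le p (b i) \<and> le (a i) q \<and> le (b i) q \<and>
      \<not> le (a i) (b i) \<and> (\<forall>j<k. j \<noteq> i \<longrightarrow> le (a i) (b j))"
    unfolding has_crown_def by blast
  have X: "\<And>i. i < k \<Longrightarrow> a i \<in> X" "\<And>i. i < k \<Longrightarrow> b i \<in> X"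
    and bnd: "\<And>i. i < k \<Longrightarrow> le p (b i)" "\<And>i. i < k \<Longrightarrow> le (a i) q" "\<And>i. i < k \<Longrightarrow> le (b i) q"
    and ab: "\<And>i. i < k \<Longrightarrow> \<not> le (a i) (b i)"
      "\<And>i j. i < k \<Longrightarrow> j < k \<Longrightarrow> j \<noteq> i \<Longrightarrow> le (a i) (b j)"
    using crown' by simp_all
  \<comment> \<open>The common upper bound \<open>q\<close> forces the antichain component of
    \<open>a i\<close> and of \<open>b i\<close> to equal its own.\<close>
  have const: "h (a i) m = h (b i) m" if "i < k" for i
  proof -
    have "h (a i) m \<subseteq> h q m" "h (b i) m \<subseteq> h q m"
      using le X bnd that pq by blast+
    then show ?thesis using antichain X that pq by metis
  qed
  have "\<exists>j<m. \<not> h (a i) j \<subseteq> h (b i) j" if i: "i < k" for i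
  proof -
    from ab(1)[OF i] le X i obtain j where j: "j \<le> m" "\<not> h (a i) j \<subseteq> h (b i) j" by blast
    moreover have "j \<noteq> m" using j const[OF i] by auto
    ultimately show ?thesis by (metis le_neq_implies_less)
  qed
  then obtain f where f: "\<And>i. i < k \<Longrightarrow> f i < m \<and> \<not> h (a i) (f i) \<subseteq> h (b i) (f i)" by metis
  have "\<not> inj_on f {..<k}"
    using f \<open>m < k\<close> by (intro pigeonhole) (metis card_lessThan card_mono finite_lessThan
        image_subsetI lessThan_iff not_le order_le_less_trans)
  then obtain i i' where i: "i < k" "i' < k" "i \<noteq> i'" "f i = f i'"
    by (auto simp: inj_on_def)
  have "h (a i) (f i) \<subseteq> h (b i) (f i) \<or> h (a i') (f i) \<subseteq> h (b i') (f i)"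
  proof (rule not_both_reversed[where X = X and le = le])
    show "h x (f i) \<subseteq> h y (f i)" if "x \<in> X" "y \<in> X" "le x y" for x y
      using that le f[of i] i by auto
  qed (use X i ab(2)[of i i'] ab(2)[of i' i] chain[of "a i" "b i" "f i"]
    chain[of "a i'" "b i'" "f i"] f[of i] in simp_all)
  with f i show False by metis
qed

text \<open>The lists \<open>js\<close> and \<open>es\<close> certify strict growth from
  \<open>P\<close> to \<open>Q\<close> in \<open>k\<close> of the \<open>k + 1\<close> components.
  For sets of naturals there are only countably many such certificates.\<close>

definition gap :: "nat \<Rightarrow> (nat \<Rightarrow> 'b set) \<Rightarrow> (nat \<Rightarrow> 'b set) \<Rightarrow> nat list \<Rightarrow> 'b list \<Rightarrow> bool" where
  "gap k P Q js es \<longleftrightarrow> length js = k \<and> length es = k \<and> distinct js \<and> set js \<subseteq> {..k} \<and>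
     (\<forall>j\<le>k. P j \<subseteq> Q j) \<and> (\<forall>i<k. es ! i \<in> Q (js ! i) - P (js ! i))"

text \<open>The \<open>k\<close> critical pairs are reversed in \<open>k\<close> different chains,
  and the bounds \<open>p\<close> and \<open>q\<close> of the crown combine all these reversals in
  one comparable pair.\<close>

lemma crown_gap:
  fixes h :: "'a \<Rightarrow> nat \<Rightarrow> 'b set"
  assumes crown: "has_crown le k X"
    and le: "\<And>x y. x \<in> X \<Longrightarrow> y \<in> X \<Longrightarrow> le x y \<longleftrightarrow> (\<forall>j\<le>k. h x j \<subseteq> h y j)"
    and chain: "\<And>x y j. x \<in> X \<Longrightarrow> y \<in> X \<Longrightarrow> j \<le> k \<Longrightarrow> h x j \<subseteq> h y j \<or> h y j \<subseteq> h x j"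
  shows "\<exists>p\<in>X. \<exists>q\<in>X. \<exists>js es. gap k (h p) (h q) js es"
proof -
  from crown obtain p q a b where pq: "p \<in> X" "q \<in> X" "le p q"
    and crown': "\<forall>i<k. a i \<in> X \<and> b i \<in> X \<and> le p (b i) \<and> le (a i) q \<and> le (b i) q \<and>
      \<not> le (a i) (b i) \<and> (\<forall>j<k. j \<noteq> i \<longrightarrow> le (a i) (b j))"
    unfolding has_crown_def by blast
  have X: "\<And>i. i < k \<Longrightarrow> a i \<in> X" "\<And>i. i < k \<Longrightarrow> b i \<in> X"
    and bnd: "\<And>i. i < k \<Longrightarrow> le p (b i)" "\<And>i. i < k \<Longrightarrow> le (a i) q" "\<And>i. i < k \<Longrightarrow> le (b i) q"
    and ab: "\<And>i. i < k \<Longrightarrow> \<not> le (a i) (b i)"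
      "\<And>i j. i < k \<Longrightarrow> j < k \<Longrightarrow> j \<noteq> i \<Longrightarrow> le (a i) (b j)"
    using crown' by simp_all
  have "\<forall>i\<in>{..<k}. \<exists>j e. j \<le> k \<and> e \<in> h (a i) j - h (b i) j"
  proof
    fix i assume "i \<in> {..<k}"
    then have i: "i < k" by simp
    show "\<exists>j e. j \<le> k \<and> e \<in> h (a i) j - h (b i) j"
    using ab(1)[OF i] unfolding le[OF X(1)[OF i] X(2)[OF i]] by blast
  qed
  then obtain f e where "\<forall>i\<in>{..<k}. f i \<le> k \<and> e i \<in> h (a i) (f i) - h (b i) (f i)"
    unfolding bchoice_iff by blast
  then have f: "\<And>i. i < k \<Longrightarrow> f i \<le> k \<and> e i \<in> h (a i) (f i) - h (b i) (f i)"
    by simp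
  have "inj_on f {..<k}"
  proof (rule inj_onI, rule ccontr)
    fix i i' assume i: "i \<in> {..<k}" "i' \<in> {..<k}" "f i = f i'" "i \<noteq> i'"
    have "h (a i) (f i) \<subseteq> h (b i) (f i) \<or> h (a i') (f i) \<subseteq> h (b i') (f i)"
    proof (rule not_both_reversed[where X = X and le = le])
      show "h x (f i) \<subseteq> h y (f i)" if "x \<in> X" "y \<in> X" "le x y" for x y
        using that le f[of i] i by auto
    qed (use X i ab(2)[of i i'] ab(2)[of i' i] chain[of "a i" "b i" "f i"]
      chain[of "a i'" "b i'" "f i"] f[of i] in simp_all)
    with f i show False by (metis DiffE lessThan_iff subsetD)
  qed
  \<comment> \<open>Since \<open>p\<close> lies below \<open>b i\<close> and \<open>q\<close> above
    \<open>a i\<close>, the witness separating \<open>a i\<close> from \<open>b i\<close> also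
    separates \<open>q\<close> from \<open>p\<close>.\<close>
  moreover have "e i \<in> h q (f i) - h p (f i)" if "i < k" for i
  proof -
    have "h p (f i) \<subseteq> h (b i) (f i)" "h (a i) (f i) \<subseteq> h q (f i)"
      using le[OF pq(1) X(2)[OF that]] le[OF X(1)[OF that] pq(2)] bnd f[OF that] that by simp_all
    then show ?thesis using f[OF that] by blast
  qed
  ultimately have "gap k (h p) (h q) (map f [0..<k]) (map e [0..<k])"
    unfolding gap_def using f le[OF pq(1,2)] pq(3)
    by (simp add: distinct_map lessThan_atLeast0 image_subset_iff)
  with pq show ?thesis by blast
qed

text \<open>The gap data leave only one of the \<open>k + 1\<close> components uncontrolled, and there the two
  chains would have to pass each other.\<close>

lemma gap_comparable:
  assumes "gap k P Q js es" "gap k P' Q' js es"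
    and chain: "\<And>j. j \<le> k \<Longrightarrow> P j \<subseteq> Q' j \<or> Q' j \<subseteq> P j" "\<And>j. j \<le> k \<Longrightarrow> P' j \<subseteq> Q j \<or> Q j \<subseteq> P' j"
  shows "(\<forall>j\<le>k. P j \<subseteq> Q' j) \<or> (\<forall>j\<le>k. P' j \<subseteq> Q j)"
proof (rule ccontr)
  assume "\<not> ?thesis"
  then obtain j j' where j: "j \<le> k" "\<not> P j \<subseteq> Q' j" "j' \<le> k" "\<not> P' j' \<subseteq> Q j'" by blast
  \<comment> \<open>A shared witness lies in \<open>Q l\<close> and \<open>Q' l\<close> but in
    neither \<open>P l\<close> nor \<open>P' l\<close>. This decides both comparisons in every
    listed component.\<close>
  have mem: "P l \<subseteq> Q' l \<and> P' l \<subseteq> Q l" if "l \<in> set js" for l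
  proof -
    from that obtain i where i: "i < k" "l = js ! i"
      using assms(1) by (auto simp: gap_def in_set_conv_nth)
    with assms have "es ! i \<in> Q l - P l" "es ! i \<in> Q' l - P' l" by (auto simp: gap_def)
    moreover have "l \<le> k" using that assms(1) by (auto simp: gap_def)
    ultimately show ?thesis using chain by blast
  qed
  have "card (set js) = k" "set js \<subseteq> {..k}"
    using assms(1) by (auto simp: gap_def distinct_card)
  then have "card ({..k} - set js) = 1" by (simp add: card_Diff_subset)
  moreover have "j \<in> {..k} - set js" "j' \<in> {..k} - set js" using j mem by blast+
  ultimately have "j = j'" by (metis card_1_singletonE singletonD)
  \<comment> \<open>If both comparisons fail in the remaining component, then \<open>Q'\<close>,
    \<open>P\<close>, \<open>Q\<close>, \<open>P'\<close>, \<open>Q'\<close> is an increasing cycle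
    whose first and third inclusions are strict.\<close>
  moreover have "P j \<subseteq> Q j" "P' j \<subseteq> Q' j" using assms j(1) by (auto simp: gap_def)
  ultimately show False using chain j by blast
qed

section \<open>Crowns in somewhere dense sets\<close>

text \<open>Points are infinite sequences, so that one completely metrizable space serves every
  \<open>k\<close>; the order looks only at the first \<open>k\<close> coordinates.\<close>

definition le_on :: "nat \<Rightarrow> (nat \<Rightarrow> real) \<Rightarrow> (nat \<Rightarrow> real) \<Rightarrow> bool" where
  "le_on k x y \<longleftrightarrow> (\<forall>i<k. x i \<le> y i)"

text \<open>A basic open set of the product topology restricts finitely many coordinates, and one
  positive radius fits them all.\<close>

lemma open_fun_box:
  fixes x :: "'i \<Rightarrow> real"
  assumes "open S" "x \<in> S"
  shows "\<exists>\<epsilon>>0. \<forall>y. (\<forall>i. \<bar>y i - x i\<bar> < \<epsilon>) \<longrightarrow> y \<in> S"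
proof -
  have "openin (product_topology (\<lambda>i. euclidean) UNIV) S"
    using assms(1) by (simp add: open_fun_def)
  from product_topology_open_contains_basis[OF this assms(2)]
  obtain U where U: "x \<in> Pi\<^sub>E UNIV U" "\<And>i. open (U i)" "finite {i. U i \<noteq> UNIV}" "Pi\<^sub>E UNIV U \<subseteq> S"
    by auto
  have "\<forall>i. \<exists>e>0. ball (x i) e \<subseteq> U i"
    using U(1,2) by (auto simp: PiE_iff open_contains_ball)
  then obtain e where e: "\<And>i. e i > 0" "\<And>i. ball (x i) (e i) \<subseteq> U i" by metis
  \<comment> \<open>The entry 1 keeps the minimum defined when no coordinate is restricted.\<close>
  define \<epsilon> where "\<epsilon> = Min (insert 1 (e ` {i. U i \<noteq> UNIV}))"
  have "\<epsilon> > 0" using U(3) e(1) by (auto simp: \<epsilon>_def)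
  moreover have "y \<in> S" if y: "\<And>i. \<bar>y i - x i\<bar> < \<epsilon>" for y
  proof -
    have "y i \<in> U i" for i
    proof (cases "U i = UNIV")
      case False
      then have "\<epsilon> \<le> e i" using U(3) by (auto simp: \<epsilon>_def)
      with y[of i] have "y i \<in> ball (x i) (e i)" by (simp add: dist_real_def abs_minus_commute)
      then show ?thesis using e(2) by blast
    qed simp
    then show ?thesis using U(4) by (auto simp: PiE_iff)
  qed
  ultimately show ?thesis by blast
qed

text \<open>Points of \<open>X\<close> approximate a pattern, in units \<open>u\<close> around
  \<open>x\<close>: \<open>p\<close> is -10 and \<open>q\<close> is 10 throughout,
  \<open>a j\<close> is 3 at \<open>j\<close> and -6 elsewhere, \<open>b j\<close> is -3 at
  \<open>j\<close> and 6 elsewhere. Values to be compared differ by at least 3 units while each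
  error is below 1, so the relations of the crown survive.\<close>

lemma somewhere_dense_has_crown:
  fixes X :: "(nat \<Rightarrow> real) set"
  assumes "interior (closure X) \<noteq> {}"
  shows "has_crown (le_on k) k X"
proof -
  from assms obtain x where "x \<in> interior (closure X)" by blast
  with open_fun_box[of "interior (closure X)" x] obtain \<epsilon> where \<epsilon>: "\<epsilon> > 0"
    and box: "\<And>y. (\<And>i. \<bar>y i - x i\<bar> < \<epsilon>) \<Longrightarrow> y \<in> interior (closure X)" by auto
  \<comment> \<open>Offsets of at most 10 units then stay within half of
    \<open>\<epsilon>\<close>.\<close>
  define u where "u = \<epsilon> / 20"
  have u: "u > 0" using \<epsilon> by (simp add: u_def)
  have approx: "\<exists>y\<in>X. \<forall>i<k. \<bar>y i - (x i + c i * u)\<bar> < u" if c: "\<And>i. \<bar>c i\<bar> \<le> 10" for c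
  proof -
    let ?c = "\<lambda>i. x i + c i * u"
    have "\<bar>?c i - x i\<bar> < \<epsilon>" for i
      using mult_right_mono[OF c, of u i] u by (simp add: abs_mult u_def)
    then have "?c \<in> closure X" using box[of ?c] interior_subset by blast
    \<comment> \<open>Only the first \<open>k\<close> coordinates are restricted, which keeps the
      box open in the product topology.\<close>
    define B where "B = {f. \<forall>i\<in>{..<k}. f i \<in> {?c i - u<..<?c i + u}}"
    have "open B" unfolding B_def by (rule product_topology_basis') auto
    moreover have "?c \<in> B" using u by (simp add: B_def)
    ultimately have "B \<inter> X \<noteq> {}"
      using \<open>?c \<in> closure X\<close> open_Int_closure_eq_empty[of B X] by blast
    then obtain y where "y \<in> X" "\<forall>i\<in>{..<k}. y i \<in> {?c i - u<..<?c i + u}"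
      unfolding B_def by blast
    then show ?thesis by (intro bexI[of _ y]) (auto simp: abs_diff_less_iff)
  qed
  obtain p where p: "p \<in> X" "\<And>i. i < k \<Longrightarrow> \<bar>p i - (x i + - 10 * u)\<bar> < u"
    using approx[of "\<lambda>_. - 10"] by auto
  obtain q where q: "q \<in> X" "\<And>i. i < k \<Longrightarrow> \<bar>q i - (x i + 10 * u)\<bar> < u"
    using approx[of "\<lambda>_. 10"] by auto
  have "\<exists>a. \<forall>j. a j \<in> X \<and> (\<forall>i<k. \<bar>a j i - (x i + (if i = j then 3 else - 6) * u)\<bar> < u)"
  proof (rule choice, rule allI)
    fix j
    have "\<exists>y\<in>X. \<forall>i<k. \<bar>y i - (x i + (if i = j then 3 else - 6) * u)\<bar> < u"
      by (rule approx) simp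
    then show "\<exists>y. y \<in> X \<and> (\<forall>i<k. \<bar>y i - (x i + (if i = j then 3 else - 6) * u)\<bar> < u)"
      by blast
  qed
  then obtain a where a: "\<And>j. a j \<in> X"
    "\<And>i j. i < k \<Longrightarrow> \<bar>a j i - (x i + (if i = j then 3 else - 6) * u)\<bar> < u" by blast
  have "\<exists>b. \<forall>j. b j \<in> X \<and> (\<forall>i<k. \<bar>b j i - (x i + (if i = j then - 3 else 6) * u)\<bar> < u)"
  proof (rule choice, rule allI)
    fix j
    have "\<exists>y\<in>X. \<forall>i<k. \<bar>y i - (x i + (if i = j then - 3 else 6) * u)\<bar> < u"
      by (rule approx) simp
    then show "\<exists>y. y \<in> X \<and> (\<forall>i<k. \<bar>y i - (x i + (if i = j then - 3 else 6) * u)\<bar> < u)"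
      by blast
  qed
  then obtain b where b: "\<And>j. b j \<in> X"
    "\<And>i j. i < k \<Longrightarrow> \<bar>b j i - (x i + (if i = j then - 3 else 6) * u)\<bar> < u" by blast
  have "p i \<le> q i" if "i < k" for i
    using p(2)[OF that] q(2)[OF that] u by linarith
  then have "le_on k p q" by (simp add: le_on_def)
  have "p i \<le> b j i \<and> a j i \<le> q i \<and> b j i \<le> q i" if "i < k" for i j
    using p(2)[OF that] q(2)[OF that] a(2)[OF that, of j] b(2)[OF that, of j] u
    by (cases "i = j") auto
  then have "le_on k p (b j)" "le_on k (a j) q" "le_on k (b j) q" for j
    by (simp_all add: le_on_def)
  moreover have "\<not> a j j \<le> b j j" if "j < k" for j
    using a(2)[OF that, of j] b(2)[OF that, of j] u by auto
  then have "\<not> le_on k (a j) (b j)" if "j < k" for j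
    using that by (auto simp: le_on_def)
  moreover have "a j i \<le> b j' i" if "i < k" "j \<noteq> j'" for i j j'
    using a(2)[OF that(1), of j] b(2)[OF that(1), of j'] u that(2)
    by (cases "i = j"; cases "i = j'") auto
  then have "le_on k (a j) (b j')" if "j \<noteq> j'" for j j'
    using that by (simp add: le_on_def)
  ultimately have "\<forall>i<k. a i \<in> X \<and> b i \<in> X \<and> le_on k p (b i) \<and> le_on k (a i) q \<and>
      le_on k (b i) q \<and> \<not> le_on k (a i) (b i) \<and> (\<forall>j<k. j \<noteq> i \<longrightarrow> le_on k (a i) (b j))"
    using a(1) b(1) by simp
  with p(1) q(1) \<open>le_on k p q\<close> show ?thesis
    unfolding has_crown_def by (intro bexI[of _ p] bexI[of _ q] conjI exI) assumption+
qed

text \<open>Sets without a crown are nowhere dense, and by Baire countably many of their closures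
  cannot cover the space.\<close>

lemma exists_avoiding:
  fixes \<X> :: "(nat \<Rightarrow> real) set set"
  assumes "countable \<X>" "\<And>X. X \<in> \<X> \<Longrightarrow> \<not> has_crown (le_on k) k X"
  shows "\<exists>x. x \<notin> \<Union>\<X>"
proof -
  have "euclidean interior_of \<Union>(closure ` \<X>) = {}"
    using assms somewhere_dense_has_crown
    by (intro Baire_category_alt disjI1 completely_metrizable_space_euclidean) auto
  moreover have "euclidean interior_of UNIV = (UNIV :: (nat \<Rightarrow> real) set)"
    using interior_of_topspace[of "euclidean :: (nat \<Rightarrow> real) topology"] by simp
  ultimately have "\<Union>(closure ` \<X>) \<noteq> UNIV" by (metis UNIV_not_empty)
  then show ?thesis using closure_subset by blast
qed

section \<open>Left cuts of reals\<close>

text \<open>Every rational is \<open>(a - b) / (c + 1)\<close> for some naturals.\<close>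

definition rat_code :: "nat \<Rightarrow> real" where
  "rat_code n = (let (a, m) = prod_decode n; (b, c) = prod_decode m
     in (real a - real b) / real (Suc c))"

definition left_cut :: "real \<Rightarrow> nat set" where
  "left_cut x = {n. rat_code n < x}"

lemma rat_code_dense:
  assumes "x < y"
  shows "\<exists>n. x < rat_code n \<and> rat_code n < y"
proof -
  from Rats_dense_in_real[OF assms] obtain r where r: "r \<in> \<rat>" "x < r" "r < y" by blast
  from r(1) obtain i :: int and m :: nat where m: "m \<noteq> 0" "r = of_int i / real m"
    unfolding Rats_eq_int_div_nat by blast
  have "rat_code (prod_encode (nat i, prod_encode (nat (- i), m - 1))) = r"
    using m by (simp add: rat_code_def)
  with r show ?thesis by metis
qed

text \<open>This turns the order of the reals into inclusion, which enumeration operators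
  preserve.\<close>

lemma left_cut_subset_iff: "left_cut x \<subseteq> left_cut y \<longleftrightarrow> x \<le> y"
proof
  assume sub: "left_cut x \<subseteq> left_cut y"
  show "x \<le> y"
  proof (rule ccontr)
    assume "\<not> x \<le> y"
    then obtain n where "y < rat_code n" "rat_code n < x" using rat_code_dense[of y x] by auto
    with sub show False by (auto simp: left_cut_def)
  qed
qed (auto simp: left_cut_def)

lemma divide_le_divide_iff:
  fixes a b c d :: real
  assumes "b > 0" "d > 0"
  shows "a / b \<le> c / d \<longleftrightarrow> a * d \<le> c * b"
  using assms by (simp add: field_simps)

text \<open>Cross-multiplication, with subtracted terms moved to the other side, leaves only sums
  and products of naturals.\<close>

lemma rat_code_le_iff:
  "rat_code n \<le> rat_code m \<longleftrightarrow>
    fst (prod_decode n) * Suc (snd (prod_decode (snd (prod_decode m)))) +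
      fst (prod_decode (snd (prod_decode m))) * Suc (snd (prod_decode (snd (prod_decode n)))) \<le>
    fst (prod_decode m) * Suc (snd (prod_decode (snd (prod_decode n)))) +
      fst (prod_decode (snd (prod_decode n))) * Suc (snd (prod_decode (snd (prod_decode m))))"
proof -
  have "(real a - real b) / real (Suc c) \<le> (real a' - real b') / real (Suc c') \<longleftrightarrow>
      a * Suc c' + b' * Suc c \<le> a' * Suc c + b * Suc c'" for a b c a' b' c'
  proof -
    have "(real a - real b) / real (Suc c) \<le> (real a' - real b') / real (Suc c') \<longleftrightarrow>
        (real a - real b) * real (Suc c') \<le> (real a' - real b') * real (Suc c)"
      by (rule divide_le_divide_iff) simp_all
    also have "\<dots> \<longleftrightarrow> real (a * Suc c' + b' * Suc c) \<le> real (a' * Suc c + b * Suc c')"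
      unfolding of_nat_add of_nat_mult left_diff_distrib by linarith
    finally show ?thesis unfolding of_nat_le_iff .
  qed
  then show ?thesis unfolding rat_code_def Let_def case_prod_beta .
qed

text \<open>Of two codes the selector picks the one of the smaller rational, as left cuts are closed
  downwards.\<close>

lemma semirecursive_cut: "semirecursive (left_cut x)"
proof -
  define f where "f n m = (if rat_code n \<le> rat_code m then n else m)" for n m
  have "recfn 2 (\<lambda>xs. f (xs ! 0) (xs ! 1))"
    unfolding f_def rat_code_le_iff
    by (intro recfn_If recrel_le recfn_add recfn_mult recfn_Suc recfn_fst_decode recfn_snd_decode
        recfn_vars) simp_all
  then have "computable2 f" by (rule computable2I)
  moreover have "f n m \<in> {n, m} \<and> (n \<in> left_cut x \<or> m \<in> left_cut x \<longrightarrow> f n m \<in> left_cut x)" for n m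
    by (auto simp: f_def left_cut_def)
  ultimately show ?thesis unfolding semirecursive_def by blast
qed

text \<open>Separates the selector from the set: there are countably many computable selectors, and
  fixing one restricts its sets to a chain.\<close>

definition selected :: "(nat \<Rightarrow> nat \<Rightarrow> nat) \<Rightarrow> nat set \<Rightarrow> bool" where
  "selected f A \<longleftrightarrow> (\<forall>n m. f n m \<in> {n, m} \<and> (n \<in> A \<or> m \<in> A \<longrightarrow> f n m \<in> A))"

lemma semirecursive_iff: "semirecursive A \<longleftrightarrow> (\<exists>f. computable2 f \<and> selected f A)"
  by (simp add: semirecursive_def selected_def)

text \<open>For \<open>n\<close> in \<open>A - B\<close> and \<open>m\<close> in
  \<open>B - A\<close>, the value \<open>f n m\<close> would lie in both sets although it is
  \<open>n\<close> or \<open>m\<close>.\<close>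

lemma selected_chain:
  assumes "selected f A" "selected f B"
  shows "A \<subseteq> B \<or> B \<subseteq> A"
proof (rule ccontr)
  assume "\<not> ?thesis"
  then obtain n m where "n \<in> A" "n \<notin> B" "m \<in> B" "m \<notin> A" by blast
  with assms show False unfolding selected_def by (metis empty_iff insert_iff)
qed

lemma list_all2_selected_chain:
  assumes "list_all2 selected fs As" "list_all2 selected fs Bs" "j < length fs"
  shows "As ! j \<subseteq> Bs ! j \<or> Bs ! j \<subseteq> As ! j"
  using assms by (intro selected_chain[of "fs ! j"]) (simp_all add: list_all2_conv_all_nth)

lemma tuple_subset_iff:
  assumes "length As = length Bs"
  shows "tuple As \<subseteq> tuple Bs \<longleftrightarrow> (\<forall>i<length As. As ! i \<subseteq> Bs ! i)"
proof
  assume *: "tuple As \<subseteq> tuple Bs"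
  show "\<forall>i<length As. As ! i \<subseteq> Bs ! i"
  proof (intro allI impI subsetI)
    fix i x assume "i < length As" "x \<in> As ! i"
    then have "prod_encode (i, x) \<in> tuple As" by (simp add: prod_encode_mem_tuple)
    with * have "prod_encode (i, x) \<in> tuple Bs" by blast
    then show "x \<in> Bs ! i" by (simp add: prod_encode_mem_tuple)
  qed
qed (use assms in \<open>fastforce simp: mem_tuple_iff\<close>)

definition cuts :: "nat \<Rightarrow> (nat \<Rightarrow> real) \<Rightarrow> nat set list" where
  "cuts k x = map (\<lambda>i. left_cut (x i)) [0..<k]"

lemma tuple_cuts_subset_iff: "tuple (cuts k x @ Zs) \<subseteq> tuple (cuts k y @ Zs) \<longleftrightarrow> le_on k x y"
  by (subst tuple_subset_iff)
    (auto simp: cuts_def le_on_def nth_append left_cut_subset_iff all_conj_distrib)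

definition total_join :: "nat set \<Rightarrow> nat set" where
  "total_join C = C \<oplus> - C"

text \<open>Positive and negative information occur together, so these sets form an antichain under
  inclusion.\<close>

lemma total_join_subset_iff: "total_join C \<subseteq> total_join D \<longleftrightarrow> C = D"
proof
  assume *: "total_join C \<subseteq> total_join D"
  have "x \<in> D" if "x \<in> C" for x
  proof -
    have "2 * x \<in> total_join D" using * that by (auto simp: total_join_def set_join_def)
    then show ?thesis by (auto simp: total_join_def set_join_def) presburger
  qed
  moreover have "x \<notin> D" if "x \<notin> C" for x
  proof -
    have "2 * x + 1 \<in> total_join D" using * that by (auto simp: total_join_def set_join_def)
    then show ?thesis by (auto simp: total_join_def set_join_def) presburger
  qed
  ultimately show "C = D" by blast
qed simp

section \<open>Tuples of cuts equivalent to tuples of semirecursive sets\<close>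

text \<open>The operators are fixed for all \<open>x\<close> at once, so that sending
  \<open>x\<close> to its tuple in \<open>T\<close> is an order embedding. The list
  \<open>Zs\<close> holds a constant extra component.\<close>

definition reals_equiv ::
  "nat set \<Rightarrow> nat set \<Rightarrow> nat set list set \<Rightarrow> nat \<Rightarrow> nat set list \<Rightarrow> (nat \<Rightarrow> real) set" where
  "reals_equiv V W T k Zs = {x. \<exists>Bs\<in>T. tuple (cuts k x @ Zs) = enum_op V (tuple Bs) \<and>
     tuple Bs = enum_op W (tuple (cuts k x @ Zs))}"

text \<open>Monotonicity of \<open>V\<close> gives one direction and monotonicity of
  \<open>W\<close> the other.\<close>

lemma enum_op_tuple_subset_iff:
  assumes "A = enum_op V B" "B = enum_op W A" "A' = enum_op V B'" "B' = enum_op W A'"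
  shows "A \<subseteq> A' \<longleftrightarrow> B \<subseteq> B'"
  using assms enum_op_mono by metis

lemma reals_equiv_embedding:
  "\<exists>H. \<forall>x\<in>reals_equiv V W T k Zs. H x \<in> T \<and>
    tuple (cuts k x @ Zs) = enum_op V (tuple (H x)) \<and>
    tuple (H x) = enum_op W (tuple (cuts k x @ Zs))"
  by (rule bchoice) (auto simp: reals_equiv_def)

text \<open>The fixed selectors supply fewer than \<open>k\<close> chains, and the total set at
  index \<open>length fs\<close> supplies the antichain.\<close>

lemma reals_equiv_total_no_crown:
  assumes "length fs < k"
  shows "\<not> has_crown (le_on k) k
    (reals_equiv V W {Bs @ [total_join C] | Bs C. list_all2 selected fs Bs} k Zs)"
    (is "\<not> has_crown _ _ ?X")
proof
  assume crown: "has_crown (le_on k) k ?X"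
  obtain H where H_def: "\<forall>x\<in>?X. H x \<in> {Bs @ [total_join C] | Bs C. list_all2 selected fs Bs} \<and>
      tuple (cuts k x @ Zs) = enum_op V (tuple (H x)) \<and>
      tuple (H x) = enum_op W (tuple (cuts k x @ Zs))"
    using reals_equiv_embedding by blast
  have H: "\<And>x. x \<in> ?X \<Longrightarrow> H x \<in> {Bs @ [total_join C] | Bs C. list_all2 selected fs Bs}"
    and V: "\<And>x. x \<in> ?X \<Longrightarrow> tuple (cuts k x @ Zs) = enum_op V (tuple (H x))"
    and W: "\<And>x. x \<in> ?X \<Longrightarrow> tuple (H x) = enum_op W (tuple (cuts k x @ Zs))"
    using H_def by blast+
  have len: "length (H x) = Suc (length fs)" if "x \<in> ?X" for x
    using H[OF that] by (auto dest: list_all2_lengthD)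
  have sel: "selected (fs ! j) (H x ! j)" if "x \<in> ?X" "j < length fs" for x j
    using H[OF that(1)] that(2) by (auto simp: list_all2_conv_all_nth nth_append)
  have last: "\<exists>C. H x ! length fs = total_join C" if "x \<in> ?X" for x
    using H[OF that] by (auto simp: list_all2_conv_all_nth nth_append)
  show False
  proof (rule no_crown_below_dimension[OF crown assms, where h = "\<lambda>x j. H x ! j"])
    fix x y assume xy: "x \<in> ?X" "y \<in> ?X"
    have "le_on k x y \<longleftrightarrow> tuple (H x) \<subseteq> tuple (H y)"
      using enum_op_tuple_subset_iff[OF V W V W] xy by (simp add: tuple_cuts_subset_iff)
    also have "\<dots> \<longleftrightarrow> (\<forall>j\<le>length fs. H x ! j \<subseteq> H y ! j)"
      using xy by (simp add: tuple_subset_iff len less_Suc_eq_le)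
    finally show "le_on k x y \<longleftrightarrow> (\<forall>j\<le>length fs. H x ! j \<subseteq> H y ! j)" .
    show "H x ! j \<subseteq> H y ! j \<or> H y ! j \<subseteq> H x ! j" if "j < length fs" for j
      using sel xy that selected_chain by blast
    show "H x ! length fs = H y ! length fs" if "H x ! length fs \<subseteq> H y ! length fs"
      using last[OF xy(1)] last[OF xy(2)] that by (auto simp: total_join_subset_iff)
  qed
qed

text \<open>Each such \<open>C\<close> yields a certificate made of two lists of naturals, and the
  certificate determines \<open>C\<close>: a shared one makes a lower tuple for one parameter lie
  below an upper tuple for the other.\<close>

lemma countable_crown_parameters:
  assumes "length fs = Suc k"
  shows "countable {C. has_crown (le_on k) k
    (reals_equiv V W {Bs. list_all2 selected fs Bs} k [total_join C])}"
    (is "countable {C. has_crown _ _ (?X C)}")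
proof -
  define good where "good C P Q js es \<longleftrightarrow> (\<exists>p q.
    tuple (cuts k p @ [total_join C]) = enum_op V (tuple P) \<and>
    tuple (cuts k q @ [total_join C]) = enum_op V (tuple Q) \<and>
    list_all2 selected fs P \<and> list_all2 selected fs Q \<and>
    gap k ((!) P) ((!) Q) js es)" for C P Q js es
  have ex: "\<exists>js es P Q. good C P Q js es" if crown: "has_crown (le_on k) k (?X C)" for C
  proof -
    obtain H where H_def: "\<forall>x\<in>?X C. H x \<in> {Bs. list_all2 selected fs Bs} \<and>
      tuple (cuts k x @ [total_join C]) = enum_op V (tuple (H x)) \<and>
      tuple (H x) = enum_op W (tuple (cuts k x @ [total_join C]))"
      using reals_equiv_embedding by blast
    have H: "\<And>x. x \<in> ?X C \<Longrightarrow> H x \<in> {Bs. list_all2 selected fs Bs}"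
      and V: "\<And>x. x \<in> ?X C \<Longrightarrow> tuple (cuts k x @ [total_join C]) = enum_op V (tuple (H x))"
      and W: "\<And>x. x \<in> ?X C \<Longrightarrow> tuple (H x) = enum_op W (tuple (cuts k x @ [total_join C]))"
      using H_def by blast+
    have len: "length (H x) = Suc k" if "x \<in> ?X C" for x
      using H[OF that] assms by (auto dest: list_all2_lengthD)
    have "\<exists>p\<in>?X C. \<exists>q\<in>?X C. \<exists>js es. gap k ((!) (H p)) ((!) (H q)) js es"
    proof (rule crown_gap[OF crown])
      fix x y assume xy: "x \<in> ?X C" "y \<in> ?X C"
      have "le_on k x y \<longleftrightarrow> tuple (H x) \<subseteq> tuple (H y)"
        using enum_op_tuple_subset_iff[OF V W V W] xy by (simp add: tuple_cuts_subset_iff)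
      also have "\<dots> \<longleftrightarrow> (\<forall>j\<le>k. H x ! j \<subseteq> H y ! j)"
        using xy by (simp add: tuple_subset_iff len less_Suc_eq_le)
      finally show "le_on k x y \<longleftrightarrow> (\<forall>j\<le>k. H x ! j \<subseteq> H y ! j)" .
      show "H x ! j \<subseteq> H y ! j \<or> H y ! j \<subseteq> H x ! j" if "j \<le> k" for j
        using list_all2_selected_chain[of fs "H x" "H y" j] H[OF xy(1)] H[OF xy(2)] that assms
        by simp
    qed
    then obtain p q js es where "p \<in> ?X C" "q \<in> ?X C" "gap k ((!) (H p)) ((!) (H q)) js es"
      by blast
    then have "good C (H p) (H q) js es"
      unfolding good_def using H V by blast
    then show ?thesis by blast
  qed
  \<comment> \<open>One certificate is chosen for each parameter; the tuples and reals behind it are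
    forgotten.\<close>
  define data where "data C = (SOME d. \<exists>P Q. good C P Q (fst d) (snd d))" for C
  have data: "\<exists>P Q. good C P Q (fst (data C)) (snd (data C))"
    if "has_crown (le_on k) k (?X C)" for C
    unfolding data_def by (rule someI_ex) (use ex[OF that] in auto)
  \<comment> \<open>The same \<open>V\<close> serves all parameters, so it carries an inclusion of
    tuples over to the cuts. Component \<open>k\<close> there is the total set, where inclusion
    means equality.\<close>
  have sub: "C = C'" if "good C P Q js es" "good C' P' Q' js es" "\<forall>j\<le>k. P ! j \<subseteq> Q' ! j"
    for C C' P Q P' Q' js es
  proof -
    from that(1,2) obtain p q where p: "tuple (cuts k p @ [total_join C]) = enum_op V (tuple P)"
      and q: "tuple (cuts k q @ [total_join C']) = enum_op V (tuple Q')"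
      and "length P = Suc k" "length Q' = Suc k"
      unfolding good_def using assms by (metis list_all2_lengthD)
    then have "tuple P \<subseteq> tuple Q'" using that(3) by (simp add: tuple_subset_iff less_Suc_eq_le)
    then have "tuple (cuts k p @ [total_join C]) \<subseteq> tuple (cuts k q @ [total_join C'])"
      unfolding p q by (rule enum_op_mono)
    then have "\<forall>i\<le>k. (cuts k p @ [total_join C]) ! i \<subseteq> (cuts k q @ [total_join C']) ! i"
      by (subst (asm) tuple_subset_iff) (simp_all add: cuts_def less_Suc_eq_le)
    then have "(cuts k p @ [total_join C]) ! k \<subseteq> (cuts k q @ [total_join C']) ! k" by blast
    then have "total_join C \<subseteq> total_join C'" by (simp add: cuts_def nth_append)
    then show "C = C'" by (simp add: total_join_subset_iff)
  qed
  have "inj_on data {C. has_crown (le_on k) k (?X C)}"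
  proof (rule inj_onI)
    fix C C' assume "C \<in> {C. has_crown (le_on k) k (?X C)}"
      "C' \<in> {C. has_crown (le_on k) k (?X C)}"
      and eq: "data C = data C'"
    then obtain P Q P' Q' where g: "good C P Q (fst (data C)) (snd (data C))"
      "good C' P' Q' (fst (data C)) (snd (data C))"
      using data[of C] data[of C'] by (metis mem_Collect_eq)
    have "(\<forall>j\<le>k. P ! j \<subseteq> Q' ! j) \<or> (\<forall>j\<le>k. P' ! j \<subseteq> Q ! j)"
    proof (rule gap_comparable)
      show "gap k ((!) P) ((!) Q) (fst (data C)) (snd (data C))"
        "gap k ((!) P') ((!) Q') (fst (data C)) (snd (data C))"
        using g by (auto simp: good_def)
      show "P ! j \<subseteq> Q' ! j \<or> Q' ! j \<subseteq> P ! j" "P' ! j \<subseteq> Q ! j \<or> Q ! j \<subseteq> P' ! j"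
        if "j \<le> k" for j
        using g that assms list_all2_selected_chain[of fs P Q' j]
          list_all2_selected_chain[of fs P' Q j] by (auto simp: good_def)
    qed
    then show "C = C'" using sub[OF g] sub[OF g(2,1)] by blast
  qed
  then show ?thesis by (rule countableI')
qed

lemma uncountable_nat_sets: "uncountable (UNIV :: nat set set)"
proof
  assume "countable (UNIV :: nat set set)"
  then obtain f :: "nat \<Rightarrow> nat set" where "range f = UNIV"
    using uncountable_def by fastforce
  then show False using Cantors_theorem[of UNIV] by (metis Pow_UNIV)
qed

section \<open>Countably many tests for being a product of the given form\<close>

definition selector_lists :: "nat \<Rightarrow> (nat \<Rightarrow> nat \<Rightarrow> nat) list set" where
  "selector_lists m = {fs. length fs = m \<and> set fs \<subseteq> {f. computable2 f}}"

lemma countable_selector_lists: "countable (selector_lists m)"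
  by (rule countable_subset[OF _ countable_lists[OF countable_computable2]])
    (auto simp: selector_lists_def)

definition operator_tests :: "nat \<Rightarrow> (nat set \<times> nat set \<times> (nat \<Rightarrow> nat \<Rightarrow> nat) list) set" where
  "operator_tests m = {V. comp_enumerable V} \<times> {W. comp_enumerable W} \<times> selector_lists m"

lemma countable_operator_tests: "countable (operator_tests m)"
  unfolding operator_tests_def
  by (intro countable_SIGMA countable_comp_enumerable countable_selector_lists)

lemma semirecursive_degrees_representatives:
  assumes "\<forall>e\<in>set ds. semirecursive_degree e"
  shows "\<exists>fs\<in>selector_lists (length ds). \<exists>Bs. list_all2 selected fs Bs \<and> ds = map edeg Bs"
  using assms
proof (induction ds)
  case (Cons d ds)
  then obtain fs Bs where "fs \<in> selector_lists (length ds)" "list_all2 selected fs Bs"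
    "ds = map edeg Bs" by auto
  moreover from Cons.prems obtain f B where "computable2 f" "selected f B" "d = edeg B"
    by (auto simp: semirecursive_degree_def semirecursive_iff)
  ultimately show ?case
    by (intro bexI[of _ "f # fs"] exI[of _ "B # Bs"]) (auto simp: selector_lists_def)
qed (simp add: selector_lists_def)

lemma equiv_tuple_reals_equiv:
  assumes "edeg (tuple (cuts k x @ Zs)) = edeg (tuple Bs)" "Bs \<in> T"
  shows "\<exists>V W. comp_enumerable V \<and> comp_enumerable W \<and> x \<in> reals_equiv V W T k Zs"
  using assms unfolding edeg_eq_iff enum_reducible_iff reals_equiv_def by blast

lemma prod_semirec_reals_equiv:
  assumes "prod_semirec m (edeg (tuple (cuts k x @ Zs)))"
  shows "\<exists>(V, W, fs)\<in>operator_tests m. x \<in> reals_equiv V W {Bs. list_all2 selected fs Bs} k Zs"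
proof -
  from assms obtain ds where ds: "length ds = m" "\<forall>e\<in>set ds. semirecursive_degree e"
    "edeg (tuple (cuts k x @ Zs)) = edeg_prod ds"
    by (auto simp: prod_semirec_def)
  from semirecursive_degrees_representatives[OF ds(2)] ds(1) obtain fs Bs
    where fs: "fs \<in> selector_lists m" "list_all2 selected fs Bs" "ds = map edeg Bs" by auto
  have "edeg (tuple (cuts k x @ Zs)) = edeg (tuple Bs)"
    unfolding ds(3) fs(3) by (rule edeg_prod_map_edeg)
  from equiv_tuple_reals_equiv[OF this, of "{Bs. list_all2 selected fs Bs}"] fs show ?thesis
    by (auto simp: operator_tests_def)
qed

lemma prod_semirec_Turing_reals_equiv:
  assumes "prod_semirec_Turing m (edeg (tuple (cuts k x @ Zs)))"
  shows "\<exists>(V, W, fs)\<in>operator_tests m.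
    x \<in> reals_equiv V W {Bs @ [total_join C] | Bs C. list_all2 selected fs Bs} k Zs"
proof -
  from assms obtain ds t where ds: "length ds = m" "\<forall>e\<in>set ds. semirecursive_degree e"
    "Turing_degree t" "edeg (tuple (cuts k x @ Zs)) = edeg_prod (ds @ [t])"
    by (auto simp: prod_semirec_Turing_def)
  from ds(3) obtain C where C: "t = edeg (total_join C)"
    by (auto simp: Turing_degree_def total_join_def)
  from semirecursive_degrees_representatives[OF ds(2)] ds(1) obtain fs Bs
    where fs: "fs \<in> selector_lists m" "list_all2 selected fs Bs" "ds = map edeg Bs" by auto
  have "edeg (tuple (cuts k x @ Zs)) = edeg (tuple (Bs @ [total_join C]))"
    using edeg_prod_map_edeg[of "Bs @ [total_join C]"] by (simp add: ds(4) fs(3) C)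
  from equiv_tuple_reals_equiv[OF this,
      of "{Bs @ [total_join C] | Bs C. list_all2 selected fs Bs}"] fs
  show ?thesis by (auto simp: operator_tests_def)
qed

section \<open>Tuples of cuts as products, and reals and parameters that avoid the tests\<close>

lemma edeg_cuts_prod:
  "edeg (tuple (cuts k x @ Zs)) = edeg_prod (map edeg (cuts k x) @ map edeg Zs)"
  using edeg_prod_map_edeg[of "cuts k x @ Zs"] by simp

lemma semirecursive_degree_cuts: "\<forall>e\<in>set (map edeg (cuts k x)). semirecursive_degree e"
  using semirecursive_cut by (auto simp: cuts_def semirecursive_degree_def)

lemma prod_semirec_cuts: "prod_semirec k (edeg (tuple (cuts k x)))"
  unfolding prod_semirec_def using edeg_cuts_prod[of k x "[]"] semirecursive_degree_cuts[of k x]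
  by (intro exI[of _ "map edeg (cuts k x)"]) (simp add: cuts_def)

lemma prod_semirec_Turing_cuts: "prod_semirec_Turing k (edeg (tuple (cuts k x @ [total_join C])))"
  unfolding prod_semirec_Turing_def
  using edeg_cuts_prod[of k x "[total_join C]"] semirecursive_degree_cuts[of k x]
  by (intro exI[of _ "map edeg (cuts k x)"] exI[of _ "edeg (total_join C)"])
    (auto simp: cuts_def Turing_degree_def total_join_def)

definition Turing_tests :: "nat \<Rightarrow> nat \<Rightarrow> nat set list \<Rightarrow> (nat \<Rightarrow> real) set set" where
  "Turing_tests m k Zs = (\<lambda>(V, W, fs).
     reals_equiv V W {Bs @ [total_join C] | Bs C. list_all2 selected fs Bs} k Zs) ` operator_tests m"

definition semirec_tests :: "nat \<Rightarrow> nat \<Rightarrow> nat set list \<Rightarrow> (nat \<Rightarrow> real) set set" where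
  "semirec_tests m k Zs = (\<lambda>(V, W, fs).
     reals_equiv V W {Bs. list_all2 selected fs Bs} k Zs) ` operator_tests m"

lemma not_prod_semirec_Turing:
  "x \<notin> \<Union>(Turing_tests m k Zs) \<Longrightarrow> \<not> prod_semirec_Turing m (edeg (tuple (cuts k x @ Zs)))"
  using prod_semirec_Turing_reals_equiv[of m k x Zs] by (fastforce simp: Turing_tests_def)

lemma not_prod_semirec:
  "x \<notin> \<Union>(semirec_tests m k Zs) \<Longrightarrow> \<not> prod_semirec m (edeg (tuple (cuts k x @ Zs)))"
  using prod_semirec_reals_equiv[of m k x Zs] by (fastforce simp: semirec_tests_def)

lemma countable_tests: "countable (Turing_tests m k Zs)" "countable (semirec_tests m k Zs)"
  by (simp_all add: Turing_tests_def semirec_tests_def countable_operator_tests)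

lemma Turing_tests_no_crown:
  "m < k \<Longrightarrow> X \<in> Turing_tests m k Zs \<Longrightarrow> \<not> has_crown (le_on k) k X"
  by (auto simp: Turing_tests_def operator_tests_def selector_lists_def
      dest: reals_equiv_total_no_crown[rotated])

text \<open>Each of the countably many tests excludes countably many parameters, and there are
  uncountably many sets of naturals.\<close>

lemma exists_semirec_tests_no_crown:
  "\<exists>C. \<forall>X\<in>semirec_tests (Suc k) k [total_join C]. \<not> has_crown (le_on k) k X"
proof -
  have "countable (\<Union>(V, W, fs)\<in>operator_tests (Suc k). {C. has_crown (le_on k) k
      (reals_equiv V W {Bs. list_all2 selected fs Bs} k [total_join C])})" (is "countable ?Bad")
    by (intro countable_UN countable_operator_tests)
      (auto simp: operator_tests_def selector_lists_def intro!: countable_crown_parameters)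
  then obtain C where "C \<notin> ?Bad" using uncountable_nat_sets by (metis UNIV_eq_I)
  then show ?thesis by (intro exI[of _ C]) (fastforce simp: semirec_tests_def)
qed

theorem corollary8p7:
  fixes n :: nat
  shows "\<exists>p\<in>enum_degrees. \<exists>q\<in>enum_degrees.
    (prod_semirec (n + 1) p \<and> \<not> prod_semirec_Turing n p) \<and>
    (prod_semirec_Turing n q \<and>
     (n \<ge> 1 \<longrightarrow> \<not> prod_semirec_Turing (n - 1) q) \<and>
     \<not> prod_semirec (n + 1) q)"
proof -
  \<comment> \<open>For \<open>p\<close>: dimension \<open>n + 1\<close> against \<open>n\<close>
    chains and a total part.\<close>
  obtain x where x: "x \<notin> \<Union>(Turing_tests n (n + 1) [])"
    using exists_avoiding[OF countable_tests(1), of n "n + 1" "[]" "n + 1"]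
      Turing_tests_no_crown[of n "n + 1"] by auto
  \<comment> \<open>For \<open>q\<close>: the parameter comes before the reals, since the sets to be
    avoided depend on it.\<close>
  obtain C where C: "\<forall>X\<in>semirec_tests (Suc n) n [total_join C]. \<not> has_crown (le_on n) n X"
    using exists_semirec_tests_no_crown by blast
  \<comment> \<open>For \<open>n = 0\<close> the truncated \<open>n - 1\<close> is not below
    \<open>n\<close>, so the Turing tests enter only when \<open>n \<ge> 1\<close>.\<close>
  define \<X> where "\<X> = semirec_tests (Suc n) n [total_join C] \<union>
    (if n \<ge> 1 then Turing_tests (n - 1) n [total_join C] else {})"
  have "countable \<X>" by (simp add: \<X>_def countable_tests)
  moreover have "\<not> has_crown (le_on n) n X" if "X \<in> \<X>" for X
    using that C Turing_tests_no_crown[of "n - 1" n X] by (auto simp: \<X>_def split: if_splits)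
  ultimately obtain y where y: "y \<notin> \<Union>\<X>" using exists_avoiding by metis
  show ?thesis
  proof (intro bexI conjI impI)
    show "prod_semirec (n + 1) (edeg (tuple (cuts (n + 1) x)))"
      by (rule prod_semirec_cuts)
    show "\<not> prod_semirec_Turing n (edeg (tuple (cuts (n + 1) x)))"
      using not_prod_semirec_Turing[OF x] by simp
    show "prod_semirec_Turing n (edeg (tuple (cuts n y @ [total_join C])))"
      by (rule prod_semirec_Turing_cuts)
    show "\<not> prod_semirec_Turing (n - 1) (edeg (tuple (cuts n y @ [total_join C])))" if "n \<ge> 1"
      using y that by (intro not_prod_semirec_Turing) (simp add: \<X>_def)
    show "\<not> prod_semirec (n + 1) (edeg (tuple (cuts n y @ [total_join C])))"
      using y by (intro not_prod_semirec) (simp add: \<X>_def)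
  qed (rule edeg_in_enum_degrees)+
qed

end
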